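(* Let $n\ge 7$ be an integer. Then: 1. $\mathrm{ex}^{(1)}(n;M_2)=\binom{n-1}{2}$ and $\mathrm{Ex}^{(1)}(n;M_2)=\{S_n\}$; 2. $\mathrm{ex}^{(2)}(n;M_2)=3n-8$ and $\mathrm{Ex}^{(2)}(n;M_2)=\{H_1(n),H_2(n)\}$; 3. $\mathrm{ex}^{(3)}(n;M_2)=2n-2$ and $\mathrm{Ex}^{(3)}(n;M_2)=\{H_3(n)\}$; 4. $\mathrm{ex}^{(4)}(n;M_2)=n+4$ and $\mathrm{Ex}^{(4)}(n;M_2)=\{H_4(n),H_5(n),H_6(n)\}$; 5. $\mathrm{ex}^{(5)}(n;M_2)=10$ and $\mathrm{Ex}^{(5)}(n;M_2)=\{K_5\cup (n-5)K_1,\ F_{10}\cup (n-7)K_1\}\cup\{H_i(n): i=7,\dots,11\}$; 6. $\mathrm{ex}^{(6)}(n;M_2)=7$ and $\mathrm{Ex}^{(6)}(n;M_2)=\{F_7\cup (n-7)K_1\}$. The Turán numbers $\mathrm{ex}^{(s)}(n;M_2)$ do not exist for $s\ge 7$.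
   Context: A 3-graph $H$ is a finite vertex set $V(H)$ together with a set of 3-element subsets of $V(H)$, called edges; $H$ is identified with its edge set and $|H|$ denotes its number of edges. All 3-graphs are considered up to isomorphism: $G\subseteq H$ means that $H$ contains a copy of $G$ (a sub-3-graph isomorphic to $G$), and the families $\mathrm{Ex}^{(s)}$ are sets of isomorphism types. $H\cup sK_1$ denotes the 3-graph obtained from $H$ by adding $s$ isolated vertices. $M_2$ is the 3-graph consisting of two disjoint edges. $H$ is $G$-free if $G\not\subseteq H$. Turán numbers of higher order. $\mathrm{ex}^{(1)}(n;M_2)$ is the maximum of $|H|$ over $n$-vertex $M_2$-free 3-graphs $H$, and $\mathrm{Ex}^{(1)}(n;M_2)$ is the family of $n$-vertex $M_2$-free 3-graphs attaining this maximum. Iteratively, for $s\ge1$, $\mathrm{ex}^{(s+1)}(n;M_2)$ is the maximum of $|H|$ over all $n$-vertex $M_2$-free 3-graphs $H$ such that $H\not\subseteq H'$ for every $H'\in \mathrm{Ex}^{(1)}(n;M_2)\cup\dots\cup\mathrm{Ex}^{(s)}(n;M_2)$, if such an $H$ exists (otherwise $\mathrm{ex}^{(s+1)}(n;M_2)$ does not exist); $\mathrm{Ex}^{(s+1)}(n;M_2)$ is the family of all such $H$ attaining the maximum. Specific 3-graphs. Let $|V|=n$, and for $A\subset V$ let $\mathrm{up}(A)=\{f\in\binom V3: f\supset A\}$. $S_n$ (full star) is the $n$-vertex 3-graph of all triples containing one fixed vertex. $K_5$ is the 3-graph of all 10 triples on 5 vertices. Let $x,y,z,v,w,u$ be six different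 vertices of $V$. Define $H_1(n)=\mathrm{up}(\{x,y\})\cup\mathrm{up}(\{x,z\})\cup\mathrm{up}(\{x,v\})\cup\{\{y,z,v\}\}$; $H_2(n)=\mathrm{up}(\{x,y\})\cup\mathrm{up}(\{x,z\})\cup\mathrm{up}(\{y,z\})$; $H_3(n)=\mathrm{up}(\{x,y\})\cup\mathrm{up}(\{x,z\})\cup\{\{x,v,w\},\{y,z,w\},\{y,z,v\}\}$; $H_4(n)=\mathrm{up}(\{x,y\})\cup\{\{x,v,z\},\{x,w,z\},\{x,v,w\},\{y,z,w\},\{y,z,v\},\{y,v,w\}\}$; $H_5(n)=\mathrm{up}(\{x,y\})\cup\{\{x,v,z\},\{x,w,u\},\{x,v,w\},\{y,z,w\},\{y,u,v\},\{y,v,w\}\}$; $H_6(n)=\mathrm{up}(\{x,y\})\cup\{\{x,v,z\},\{x,w,u\},\{x,v,w\},\{y,z,w\},\{y,u,v\},\{x,z,u\}\}$. Let $U=\{x_1,x_2,x_3,y_1,y_2,y_3\}$ (six different vertices). The triangle is $C_3=\{\{x_1,y_3,x_2\},\{x_1,y_2,x_3\},\{x_2,y_1,x_3\}\}$. Put $A_1=\{\{x_i,y_i,y_j\}: i,j\in\{1,2,3\}, i\ne j\}$ (6 triples); $A_2=\{\{x_i,x_j,y_j\}: i,j\in\{1,2,3\}, i\neq j\}$ (6 triples); $A_3=(A_1\setminus\{\{x_1,y_1,y_2\}\})\cup\{\{x_2,x_3,y_3\}\}$; $A_4=(A_1\setminus\{\{x_1,y_1,y_2\},\{x_1,y_1,y_3\}\})\cup\{\{x_2,x_3,y_3\},\{x_2,x_3,y_2\}\}$.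 On vertex set $U$ define $H_7(6)=C_3\cup\{\{x_1,x_2,x_3\}\}\cup A_1$ and, for $i=8,9,10,11$, $H_i(6)=C_3\cup\{\{y_1,y_2,y_3\}\}\cup A_{i-7}$. For $i=7,\dots,11$ and $n\ge7$, $H_i(n)=H_i(6)\cup(n-6)K_1$. $F_7$ (the Fano plane) is the 3-graph on 7 vertices $U\cup\{z\}$ with edges $C_3\cup\{\{x_1,z,y_1\},\{x_2,z,y_2\},\{x_3,z,y_3\},\{y_1,y_2,y_3\}\}$. $F_{10}$ is the 3-graph on 7 vertices $U\cup\{z\}$ with edges $C_3\cup\{\{x_1,x_2,x_3\},\{x_1,x_2,z\},\{x_1,z,x_3\},\{z,x_2,x_3\},\{x_1,y_1,z\},\{x_2,y_2,z\},\{x_3,y_3,z\}\}$. *)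

theory Defs
  imports Complex_Main
begin

type_synonym 'a hypergraph = "'a set \<times> 'a set set"

abbreviation verts :: "'a hypergraph \<Rightarrow> 'a set" where
  "verts \<equiv> fst"

abbreviation edges :: "'a hypergraph \<Rightarrow> 'a set set" where
  "edges \<equiv> snd"

definition triples :: "'a set \<Rightarrow> 'a set set" where
  "triples V = {f. f \<subseteq> V \<and> card f = 3}"

definition is_3graph :: "'a hypergraph \<Rightarrow> bool" where
  "is_3graph H \<longleftrightarrow> finite (verts H) \<and> edges H \<subseteq> triples (verts H)"

definition isomorphic :: "'a hypergraph \<Rightarrow> 'b hypergraph \<Rightarrow> bool" where
  "isomorphic G H \<longleftrightarrow>
     (\<exists>\<phi>. bij_betw \<phi> (verts G) (verts H) \<and> edges H = (\<lambda>e. \<phi> ` e) ` edges G)"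

definition contains_copy :: "'b hypergraph \<Rightarrow> 'a hypergraph \<Rightarrow> bool" where
  "contains_copy H G \<longleftrightarrow>
     (\<exists>K. is_3graph K \<and> verts K \<subseteq> verts H \<and> edges K \<subseteq> edges H \<and> isomorphic G K)"

text \<open>The isomorphism type of a 3-graph (over any vertex type) is the class of all 3-graphs
  on natural-number vertices that are isomorphic to it; every finite 3-graph has such a
  representative.\<close>

definition iso_type :: "'a hypergraph \<Rightarrow> nat hypergraph set" where
  "iso_type G = {H. is_3graph H \<and> isomorphic G H}"


text \<open>The \<open>n\<close>-vertex \<open>G\<close>-free 3-graphs contained in no member of \<open>\<F>\<close>.\<close>

definition candidates ::
    "'a hypergraph \<Rightarrow> nat \<Rightarrow> nat hypergraph set \<Rightarrow> nat hypergraph set" where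
  "candidates G n \<F> = {H. is_3graph H \<and> card (verts H) = n \<and> \<not> contains_copy H G \<and>
     (\<forall>H'\<in>\<F>. \<not> contains_copy H' H)}"

definition max_edges :: "nat hypergraph set \<Rightarrow> nat hypergraph set" where
  "max_edges \<C> = {H\<in>\<C>. \<forall>K\<in>\<C>. card (edges K) \<le> card (edges H)}"

text \<open>The members of the \<open>s\<close>-th extremal family as concrete 3-graphs. Orders start at
  \<open>s = 1\<close>; the value at \<open>s = 0\<close> is never used below.\<close>

fun extremal :: "'a hypergraph \<Rightarrow> nat \<Rightarrow> nat \<Rightarrow> nat hypergraph set" where
  "extremal G n s = max_edges (candidates G n (\<Union>t\<in>{1..<s}. extremal G n t))"

declare extremal.simps [simp del]

definition turan_candidates :: "nat \<Rightarrow> nat \<Rightarrow> 'a hypergraph \<Rightarrow> nat hypergraph set" where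
  "turan_candidates s n G = candidates G n (\<Union>t\<in>{1..<s}. extremal G n t)"

text \<open>\<open>turan_ex s n G\<close> is the Turan number of order \<open>s\<close>, with \<open>None\<close> for "does not exist".
  \<open>turan_Ex s n G\<close> is the corresponding family of isomorphism types.\<close>

definition turan_ex :: "nat \<Rightarrow> nat \<Rightarrow> 'a hypergraph \<Rightarrow> nat option" where
  "turan_ex s n G =
     (if turan_candidates s n G = {} then None
      else Some (Max ((\<lambda>H. card (edges H)) ` turan_candidates s n G)))"

definition turan_Ex :: "nat \<Rightarrow> nat \<Rightarrow> 'a hypergraph \<Rightarrow> nat hypergraph set set" where
  "turan_Ex s n G = iso_type ` extremal G n s"


definition add_isolated :: "'a hypergraph \<Rightarrow> nat \<Rightarrow> ('a + nat) hypergraph" where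
  "add_isolated H s = (verts H <+> {..<s}, (\<lambda>e. Inl ` e) ` edges H)"

definition M2 :: "nat hypergraph" where
  "M2 = ({..<6}, {{0, 1, 2}, {3, 4, 5}})"

definition K5 :: "nat hypergraph" where
  "K5 = ({..<5}, triples {..<5})"

definition up :: "nat \<Rightarrow> nat set \<Rightarrow> nat set set" where
  "up n A = {f \<in> triples {..<n}. A \<subseteq> f}"

definition full_star :: "nat \<Rightarrow> nat hypergraph" where
  "full_star n = ({..<n}, up n {0})"

definition H1 :: "nat \<Rightarrow> nat hypergraph" where
  "H1 n = (let x = 0; y = 1; z = 2; v = 3 in
     ({..<n}, up n {x, y} \<union> up n {x, z} \<union> up n {x, v} \<union> {{y, z, v}}))"

definition H2 :: "nat \<Rightarrow> nat hypergraph" where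
  "H2 n = (let x = 0; y = 1; z = 2 in
     ({..<n}, up n {x, y} \<union> up n {x, z} \<union> up n {y, z}))"

definition H3 :: "nat \<Rightarrow> nat hypergraph" where
  "H3 n = (let x = 0; y = 1; z = 2; v = 3; w = 4 in
     ({..<n}, up n {x, y} \<union> up n {x, z} \<union> {{x, v, w}, {y, z, w}, {y, z, v}}))"

definition H4 :: "nat \<Rightarrow> nat hypergraph" where
  "H4 n = (let x = 0; y = 1; z = 2; v = 3; w = 4 in
     ({..<n}, up n {x, y} \<union>
       {{x, v, z}, {x, w, z}, {x, v, w}, {y, z, w}, {y, z, v}, {y, v, w}}))"

definition H5 :: "nat \<Rightarrow> nat hypergraph" where
  "H5 n = (let x = 0; y = 1; z = 2; v = 3; w = 4; u = 5 in
     ({..<n}, up n {x, y} \<union>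
       {{x, v, z}, {x, w, u}, {x, v, w}, {y, z, w}, {y, u, v}, {y, v, w}}))"

definition H6 :: "nat \<Rightarrow> nat hypergraph" where
  "H6 n = (let x = 0; y = 1; z = 2; v = 3; w = 4; u = 5 in
     ({..<n}, up n {x, y} \<union>
       {{x, v, z}, {x, w, u}, {x, v, w}, {y, z, w}, {y, u, v}, {x, z, u}}))"


text \<open>The vertices \<open>x\<^sub>1, x\<^sub>2, x\<^sub>3\<close> are \<open>X 1, X 2, X 3\<close>, the vertices \<open>y\<^sub>1, y\<^sub>2, y\<^sub>3\<close> are
  \<open>Y 1, Y 2, Y 3\<close>, and \<open>Z\<close> is the seventh vertex \<open>z\<close>.\<close>

datatype vertex = X nat | Y nat | Z

definition U :: "vertex set" where
  "U = {X 1, X 2, X 3, Y 1, Y 2, Y 3}"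

definition C3 :: "vertex set set" where
  "C3 = {{X 1, Y 3, X 2}, {X 1, Y 2, X 3}, {X 2, Y 1, X 3}}"

definition A1 :: "vertex set set" where
  "A1 = {{X i, Y i, Y j} | i j. i \<in> {1, 2, 3} \<and> j \<in> {1, 2, 3} \<and> i \<noteq> j}"

definition A2 :: "vertex set set" where
  "A2 = {{X i, X j, Y j} | i j. i \<in> {1, 2, 3} \<and> j \<in> {1, 2, 3} \<and> i \<noteq> j}"

definition A3 :: "vertex set set" where
  "A3 = (A1 - {{X 1, Y 1, Y 2}}) \<union> {{X 2, X 3, Y 3}}"

definition A4 :: "vertex set set" where
  "A4 = (A1 - {{X 1, Y 1, Y 2}, {X 1, Y 1, Y 3}}) \<union> {{X 2, X 3, Y 3}, {X 2, X 3, Y 2}}"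

text \<open>\<open>H7\<close> to \<open>H11\<close> are the 6-vertex graphs \<open>H\<^sub>i(6)\<close>; for \<open>n \<ge> 7\<close>, \<open>H\<^sub>i(n)\<close> is
  \<open>add_isolated H\<^sub>i (n - 6)\<close>.\<close>

definition H7 :: "vertex hypergraph" where
  "H7 = (U, C3 \<union> {{X 1, X 2, X 3}} \<union> A1)"

definition H8 :: "vertex hypergraph" where
  "H8 = (U, C3 \<union> {{Y 1, Y 2, Y 3}} \<union> A1)"

definition H9 :: "vertex hypergraph" where
  "H9 = (U, C3 \<union> {{Y 1, Y 2, Y 3}} \<union> A2)"

definition H10 :: "vertex hypergraph" where
  "H10 = (U, C3 \<union> {{Y 1, Y 2, Y 3}} \<union> A3)"

definition H11 :: "vertex hypergraph" where
  "H11 = (U, C3 \<union> {{Y 1, Y 2, Y 3}} \<union> A4)"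

definition F7 :: "vertex hypergraph" where
  "F7 = (U \<union> {Z}, C3 \<union> {{X 1, Z, Y 1}, {X 2, Z, Y 2}, {X 3, Z, Y 3}, {Y 1, Y 2, Y 3}})"

definition F10 :: "vertex hypergraph" where
  "F10 = (U \<union> {Z}, C3 \<union> {{X 1, X 2, X 3}, {X 1, X 2, Z}, {X 1, Z, X 3}, {Z, X 2, X 3},
     {X 1, Y 1, Z}, {X 2, Y 2, Z}, {X 3, Y 3, Z}})"

end

theory Submission
  imports Defs
begin

text \<open>A family of pairwise intersecting triples that is not a star either has a cover \<open>{x, y}\<close> or
  has no cover of size two. In the first case the links of \<open>x\<close> and \<open>y\<close> are two cross-intersecting
  graphs, and the possible shapes of such a pair lead to \<open>H\<^sub>1, \<dots>, H\<^sub>6\<close>. In the second case the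
  family lives on five vertices or contains the triangle \<open>C\<^sub>3\<close>; a triangle forces at most one vertex
  outside its six vertices to be used, which leaves a finite search on seven vertices with outcome
  \<open>F\<^sub>7\<close>, \<open>F\<^sub>1\<^sub>0\<close>, \<open>H\<^sub>7, \<dots>, H\<^sub>1\<^sub>1\<close>. A 3-graph has at least as many covers of a given size as any
  3-graph on equally many vertices that contains it, and this separates all the orders except the last
  two: there, every pair of the seven vertices of \<open>F\<^sub>7\<close> is contained in an edge, which
  happens in none of the families of size ten.\<close>

section \<open>Copies, isomorphism and extremal families\<close>

text \<open>The recursive definition becomes a static claim about fifteen graphs in six levels:
  sizes fall strictly from level to level, every n-vertex \<open>M2\<close>-free graph embeds into
  some member, and no member of a later level embeds into a member of an earlier one. The last point
  is the obstacle: it must hold for all n \<ge> 7 at once, so no search over embeddings is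
  available. Hence the invariants. The star has a cover of size one and no later family has one; the
  numbers of two-element covers at the orders 2 to 6 are 3, 2, 1, 0, 0, and the upper bounds can be
  read off from the first seven vertices. The triangle comes from the absence of two-element covers:
  an edge {a, b, c} and an edge avoiding b and c share exactly a, and an edge missing a closes a
  triangle as soon as it leaves the other four vertices.\<close>

lemma is_3graph_edge:
  assumes "is_3graph G" "e \<in> edges G"
  shows "e \<subseteq> verts G" "card e = 3" "finite e"
  using assms by (auto simp: is_3graph_def triples_def intro: finite_subset)

text \<open>Replaces the sub-3-graph \<open>K\<close> of the definition by an injection on vertices;
  the image of \<open>G\<close> serves as \<open>K\<close>.\<close>

lemma contains_copyI:
  assumes G: "is_3graph G" and inj: "inj_on \<phi> (verts G)" and V: "\<phi> ` verts G \<subseteq> verts H"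
    and E: "\<And>e. e \<in> edges G \<Longrightarrow> \<phi> ` e \<in> edges H"
  shows "contains_copy H G"
  unfolding contains_copy_def
proof (intro exI conjI)
  let ?K = "(\<phi> ` verts G, (\<lambda>e. \<phi> ` e) ` edges G)"
  have "\<phi> ` e \<in> triples (\<phi> ` verts G)" if "e \<in> edges G" for e
    using is_3graph_edge[OF G that] card_image[OF inj_on_subset[OF inj]] by (auto simp: triples_def)
  then show "is_3graph ?K" using G by (auto simp: is_3graph_def)
  show "isomorphic G ?K" using inj by (auto simp: isomorphic_def bij_betw_def)
qed (use V E in auto)

lemma contains_copyE:
  assumes "contains_copy H G"
  obtains \<phi> where "inj_on \<phi> (verts G)" "\<phi> ` verts G \<subseteq> verts H"
    "\<And>e. e \<in> edges G \<Longrightarrow> \<phi> ` e \<in> edges H"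
proof -
  obtain K where "verts K \<subseteq> verts H" "edges K \<subseteq> edges H" "isomorphic G K"
    using assms unfolding contains_copy_def by blast
  moreover obtain \<phi> where "bij_betw \<phi> (verts G) (verts K)" "edges K = (\<lambda>e. \<phi> ` e) ` edges G"
    using calculation(3) unfolding isomorphic_def by blast
  ultimately show ?thesis using that[of \<phi>] by (auto simp: bij_betw_def)
qed

lemma isomorphic_refl: "isomorphic G G"
  by (auto simp: isomorphic_def intro!: exI[of _ id])

lemma isomorphic_trans:
  assumes "isomorphic G H" "isomorphic H K"
  shows "isomorphic G K"
proof -
  obtain f where f: "bij_betw f (verts G) (verts H)" "edges H = (\<lambda>e. f ` e) ` edges G"
    using assms(1) unfolding isomorphic_def by blast
  obtain g where g: "bij_betw g (verts H) (verts K)" "edges K = (\<lambda>e. g ` e) ` edges H"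
    using assms(2) unfolding isomorphic_def by blast
  have "edges K = (\<lambda>e. (g \<circ> f) ` e) ` edges G"
    unfolding f(2) g(2) by (simp add: image_image)
  then show ?thesis
    unfolding isomorphic_def using bij_betw_trans[OF f(1) g(1)] by blast
qed

text \<open>The inverse map recovers an edge only if the edge consists of vertices, which is what
  the first hypothesis says. In this form the lemma applies to the \<open>add_isolated\<close>
  graphs directly.\<close>

lemma isomorphic_sym_Pow:
  assumes "edges G \<subseteq> Pow (verts G)" "isomorphic G H"
  shows "isomorphic H G"
proof -
  obtain f where f: "bij_betw f (verts G) (verts H)" "edges H = (\<lambda>e. f ` e) ` edges G"
    using assms unfolding isomorphic_def by blast
  have "inv_into (verts G) f ` f ` e = e" if "e \<in> edges G" for e
    using inv_into_image_cancel[OF bij_betw_imp_inj_on[OF f(1)]] assms(1) that by blast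
  then have "edges G = (\<lambda>e. inv_into (verts G) f ` e) ` edges H"
    unfolding f(2) image_image by simp
  then show ?thesis
    unfolding isomorphic_def using bij_betw_inv_into[OF f(1)] by blast
qed

lemma isomorphic_sym: "is_3graph G \<Longrightarrow> isomorphic G H \<Longrightarrow> isomorphic H G"
  by (rule isomorphic_sym_Pow) (auto dest: is_3graph_edge)

lemma isomorphic_is_3graph:
  assumes "is_3graph G" "isomorphic G H"
  shows "is_3graph H"
proof -
  obtain f where f: "bij_betw f (verts G) (verts H)" "edges H = (\<lambda>e. f ` e) ` edges G"
    using assms unfolding isomorphic_def by blast
  have "f ` e \<in> triples (verts H)" if "e \<in> edges G" for e
    using is_3graph_edge[OF assms(1) that] f(1)
    by (auto simp: triples_def bij_betw_def card_image inj_on_subset)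
  then show ?thesis
    using f assms(1) bij_betw_finite[OF f(1)] by (auto simp: is_3graph_def)
qed

lemma isomorphic_contains_copy:
  assumes "is_3graph G" "isomorphic G H"
  shows "contains_copy H G"
  unfolding contains_copy_def
  by (rule exI[of _ H]) (use assms isomorphic_is_3graph[OF assms] in auto)

lemma contains_copy_trans:
  assumes "is_3graph F" "contains_copy G F" "contains_copy H G"
  shows "contains_copy H F"
proof -
  obtain f where f: "inj_on f (verts F)" "f ` verts F \<subseteq> verts G"
      "\<And>e. e \<in> edges F \<Longrightarrow> f ` e \<in> edges G"
    using contains_copyE[OF assms(2)] by blast
  obtain g where g: "inj_on g (verts G)" "g ` verts G \<subseteq> verts H"
      "\<And>e. e \<in> edges G \<Longrightarrow> g ` e \<in> edges H"
    using contains_copyE[OF assms(3)] by blast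
  show ?thesis
    by (rule contains_copyI[of _ "g \<circ> f"])
       (use assms f g in \<open>auto simp: image_image[symmetric] intro: comp_inj_on inj_on_subset\<close>)
qed

lemma isomorphic_card:
  assumes "is_3graph G" "isomorphic G H"
  shows "card (verts H) = card (verts G)" "card (edges H) = card (edges G)"
proof -
  obtain f where f: "bij_betw f (verts G) (verts H)" "edges H = (\<lambda>e. f ` e) ` edges G"
    using assms unfolding isomorphic_def by blast
  show "card (verts H) = card (verts G)"
    using bij_betw_same_card[OF f(1)] by simp
  have "inj_on (\<lambda>e. f ` e) (Pow (verts G))"
    using inj_on_image_Pow[OF bij_betw_imp_inj_on[OF f(1)]] .
  then have "inj_on (\<lambda>e. f ` e) (edges G)"
    by (rule inj_on_subset) (use is_3graph_edge[OF assms(1)] in auto)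
  then show "card (edges H) = card (edges G)" by (simp add: f(2) card_image)
qed

lemma finite_edges: "is_3graph G \<Longrightarrow> finite (edges G)"
  by (rule finite_subset[of _ "Pow (verts G)"]) (auto simp: is_3graph_def triples_def)

lemma contains_copy_card_edges:
  assumes "is_3graph G" "is_3graph H" "contains_copy H G"
  shows "card (edges G) \<le> card (edges H)"
proof -
  obtain K where "is_3graph K" "edges K \<subseteq> edges H" "isomorphic G K"
    using assms(3) unfolding contains_copy_def by blast
  then show ?thesis
    using isomorphic_card(2)[OF assms(1), of K] card_mono[OF finite_edges[OF assms(2)], of "edges K"] by simp
qed

text \<open>The copy inside \<open>H\<close> has all the vertices and at least as many edges, so it
  is \<open>H\<close> itself. This yields uniqueness of the extremal graphs.\<close>

lemma contains_copy_isomorphic: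
  assumes "is_3graph G" "is_3graph H" "contains_copy H G"
    and "card (verts G) = card (verts H)" "card (edges H) \<le> card (edges G)"
  shows "isomorphic G H"
proof -
  obtain K where K: "is_3graph K" "verts K \<subseteq> verts H" "edges K \<subseteq> edges H" "isomorphic G K"
    using assms(3) unfolding contains_copy_def by blast
  have "edges K = edges H"
    using card_seteq[OF finite_edges[OF assms(2)] K(3)] isomorphic_card(2)[OF assms(1) K(4)] assms(5)
    by simp
  moreover have "verts K = verts H"
    using K assms isomorphic_card[OF assms(1) K(4)] by (intro card_subset_eq) (auto simp: is_3graph_def)
  ultimately have "K = H" by (simp add: prod_eq_iff)
  then show ?thesis using K by simp
qed

lemma iso_type_eq:
  assumes "is_3graph G" "isomorphic G H"
  shows "iso_type G = iso_type H"
  using isomorphic_trans[OF assms(2)] isomorphic_trans[OF isomorphic_sym[OF assms]]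
  unfolding iso_type_def by auto

section \<open>The recursion over orders reduced to a fixed list of levels\<close>

lemma extremal_eq_max_edges: "extremal G n s = max_edges (turan_candidates s n G)"
  by (subst extremal.simps) (simp only: turan_candidates_def)

text \<open>Meant for the set of candidates, which is infinite because vertex names range over all
  natural numbers; only the set of their sizes is finite, thanks to the bound at
  \<open>x\<close>.\<close>

lemma Max_image_eqI:
  assumes "x \<in> A" "\<And>y. y \<in> A \<Longrightarrow> f y \<le> (f x :: nat)"
  shows "Max (f ` A) = f x"
proof (rule Max_eqI)
  show "finite (f ` A)" by (rule finite_subset[of _ "{..f x}"]) (use assms in auto)
qed (use assms in auto)

text \<open>Separates the recursion from the combinatorics. A candidate of order \<open>s\<close>
  embeds into some member of \<open>L t\<close>; the orders below \<open>s\<close> are forbidden to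
  it, so \<open>s \<le> t\<close> and its size is at most \<open>e t \<le> e s\<close>, with
  equality only if \<open>t = s\<close> and the embedding is an isomorphism. Conversely
  \<open>not_contained\<close> makes the members of \<open>L s\<close> candidates. Beyond
  \<open>m\<close> every \<open>M2\<close>-free graph (here: every \<open>G\<close>-free one) is
  already contained in an earlier family.\<close>

lemma extremal_hierarchy:
  fixes L :: "nat \<Rightarrow> nat hypergraph set" and e :: "nat \<Rightarrow> nat"
  assumes G: "is_3graph G"
    and nonempty: "\<And>s. s \<in> {1..m} \<Longrightarrow> L s \<noteq> {}"
    and graph: "\<And>s H. s \<in> {1..m} \<Longrightarrow> H \<in> L s \<Longrightarrow> is_3graph H \<and> card (verts H) = n"
    and free: "\<And>s H. s \<in> {1..m} \<Longrightarrow> H \<in> L s \<Longrightarrow> \<not> contains_copy H G"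
    and size: "\<And>s H. s \<in> {1..m} \<Longrightarrow> H \<in> L s \<Longrightarrow> card (edges H) = e s"
    and decr: "\<And>s t. 1 \<le> s \<Longrightarrow> s < t \<Longrightarrow> t \<le> m \<Longrightarrow> e t < e s"
    and not_contained: "\<And>s t H K. 1 \<le> s \<Longrightarrow> s < t \<Longrightarrow> t \<le> m \<Longrightarrow> H \<in> L s \<Longrightarrow> K \<in> L t \<Longrightarrow>
      \<not> contains_copy H K"
    and contained: "\<And>K :: nat hypergraph. is_3graph K \<Longrightarrow> card (verts K) = n \<Longrightarrow> \<not> contains_copy K G \<Longrightarrow>
      \<exists>s\<in>{1..m}. \<exists>H\<in>L s. contains_copy H K"
  shows "s \<in> {1..m} \<Longrightarrow> turan_ex s n G = Some (e s) \<and> turan_Ex s n G = iso_type ` L s"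
    and "s > m \<Longrightarrow> turan_ex s n G = None"
proof -
  \<comment> \<open>\<open>extremal\<close> consists of concrete graphs on natural numbers and is
    closed under isomorphism, while \<open>L t\<close> holds chosen representatives;
    \<open>T t\<close> is their closure.\<close>
  define T where "T t = {K :: nat hypergraph. is_3graph K \<and> (\<exists>H\<in>L t. isomorphic H K)}" for t
  have T_graph: "card (verts K) = n \<and> card (edges K) = e t"
    if "K \<in> T t" "t \<in> {1..m}" for K t
  proof -
    obtain H where "H \<in> L t" "isomorphic H K" using \<open>K \<in> T t\<close> unfolding T_def by blast
    then show ?thesis
      using isomorphic_card[of H K] graph[OF that(2)] size[OF that(2)] by auto
  qed
  have contains_T: "\<exists>H'\<in>L t. contains_copy H' K"
    if "H \<in> T t" "t \<in> {1..m}" "contains_copy H K" "is_3graph K"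
    for H K :: "nat hypergraph" and t
  proof -
    obtain H' where "H' \<in> L t" "isomorphic H' H" using \<open>H \<in> T t\<close> unfolding T_def by auto
    moreover have "contains_copy H' H"
      using isomorphic_contains_copy[OF _ isomorphic_sym[OF _ calculation(2)]] calculation(1)
        graph[OF that(2)] that(1) unfolding T_def by auto
    ultimately show ?thesis using contains_copy_trans[OF that(4,3)] by blast
  qed
  have L_T: "L t \<subseteq> T t" if "t \<in> {1..m}" for t
  proof
    fix H assume "H \<in> L t"
    then show "H \<in> T t" using graph[OF that] isomorphic_refl[of H] unfolding T_def by blast
  qed
  \<comment> \<open>The shape of the candidate set is assumed here and supplied by the strong
    induction in \<open>cand\<close>, which in turn uses this fact for smaller orders.\<close>
  have extremal_eq: "extremal G n s = T s"
    if "s \<in> {1..m}" and C: "turan_candidates s n G = candidates G n (\<Union>t\<in>{1..<s}. T t)" for s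
  proof -
    define C where "C = candidates G n (\<Union>t\<in>{1..<s}. T t)"
    have T_C: "K \<in> C" if "K \<in> T s" for K
    proof -
      obtain H where H: "H \<in> L s" "isomorphic H K" using \<open>K \<in> T s\<close> unfolding T_def by blast
      have K: "is_3graph K" using that unfolding T_def by blast
      have H3: "is_3graph H" using graph \<open>s \<in> {1..m}\<close> H(1) by blast
      have KH: "contains_copy K H" using isomorphic_contains_copy[OF H3 H(2)] .
      have HK: "contains_copy H K" using isomorphic_contains_copy[OF K isomorphic_sym[OF H3 H(2)]] .
      have "\<not> contains_copy H' K" if t: "t \<in> {1..<s}" and H': "H' \<in> T t" for t H'
      proof
        assume c: "contains_copy H' K"
        have tm: "t \<in> {1..m}" using t \<open>s \<in> {1..m}\<close> by auto
        obtain H'' where "H'' \<in> L t" "contains_copy H'' K"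
          using contains_T[OF H' tm c K] by blast
        then show False
          using contains_copy_trans[OF H3 KH, of H''] not_contained[of t s H'' H] H(1) t \<open>s \<in> {1..m}\<close>
          by simp
      qed
      moreover have "\<not> contains_copy K G"
        using contains_copy_trans[OF G _ HK] free[OF \<open>s \<in> {1..m}\<close> H(1)] by auto
      ultimately show ?thesis
        using K T_graph[OF that \<open>s \<in> {1..m}\<close>] unfolding C_def candidates_def by auto
    qed
    have bound: "card (edges K) \<le> e s \<and> (card (edges K) = e s \<longrightarrow> K \<in> T s)" if "K \<in> C" for K
    proof -
      have K: "is_3graph K" "card (verts K) = n" "\<not> contains_copy K G"
        "\<And>t H. t \<in> {1..<s} \<Longrightarrow> H \<in> T t \<Longrightarrow> \<not> contains_copy H K"
        using that unfolding C_def candidates_def by auto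
      obtain t H where t: "t \<in> {1..m}" "H \<in> L t" "contains_copy H K"
        using contained[OF K(1-3)] by blast
      then have "s \<le> t" using K(4)[of t H] subsetD[OF L_T[OF t(1)]] by (meson atLeastLessThan_iff atLeastAtMost_iff not_le)
      have "card (edges K) \<le> e t"
        using contains_copy_card_edges[OF K(1) _ t(3)] graph[OF t(1,2)] size[OF t(1,2)] by auto
      moreover have "K \<in> T s" if "card (edges K) = e s" "t = s"
        using isomorphic_sym[OF K(1) contains_copy_isomorphic[OF K(1) _ t(3)]] graph[OF t(1,2)]
          size[OF t(1,2)] that K(1,2) t(2) unfolding T_def by auto
      moreover have "e t < e s" if "t \<noteq> s"
        using decr[of s t] \<open>s \<le> t\<close> that t(1) \<open>s \<in> {1..m}\<close> by auto
      ultimately show ?thesis by (cases "t = s") auto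
    qed
    obtain H where "H \<in> L s" using nonempty \<open>s \<in> {1..m}\<close> by blast
    then have H: "H \<in> T s" "card (edges H) = e s" using L_T size \<open>s \<in> {1..m}\<close> by blast+
    have "max_edges C = T s"
    proof (intro subset_antisym subsetI)
      fix K assume "K \<in> max_edges C"
      then have "K \<in> C" "e s \<le> card (edges K)" using T_C[OF H(1)] H(2) unfolding max_edges_def by auto
      then show "K \<in> T s" using bound[of K] by auto
    next
      fix K assume "K \<in> T s"
      then show "K \<in> max_edges C"
        using T_C bound T_graph[OF _ \<open>s \<in> {1..m}\<close>] unfolding max_edges_def by auto
    qed
    then show ?thesis
      using C unfolding C_def extremal_eq_max_edges by simp
  qed
  have cand: "turan_candidates s n G = candidates G n (\<Union>t\<in>{1..<s}. T t)" if "s \<le> Suc m" for s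
    using that
  proof (induction s rule: less_induct)
    case (less s)
    then have "extremal G n t = T t" if "t \<in> {1..<s}" for t
      using extremal_eq[of t] that by auto
    then show ?case unfolding turan_candidates_def by simp
  qed
  have ext: "extremal G n s = T s" if "s \<in> {1..m}" for s
    using extremal_eq[OF that] cand that by auto
  show "turan_ex s n G = Some (e s) \<and> turan_Ex s n G = iso_type ` L s" if s: "s \<in> {1..m}"
  proof
    obtain H where "H \<in> L s" using nonempty s by blast
    then have H: "H \<in> extremal G n s" "card (edges H) = e s" using L_T size s ext by blast+
    then have "H \<in> turan_candidates s n G" 
      and "\<And>K. K \<in> turan_candidates s n G \<Longrightarrow> card (edges K) \<le> card (edges H)"
      unfolding extremal_eq_max_edges max_edges_def by blast+
    then show "turan_ex s n G = Some (e s)"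
      using Max_image_eqI[of H "turan_candidates s n G" "\<lambda>K. card (edges K)"] H(2)
      by (auto simp: turan_ex_def)
    have "iso_type ` T s = iso_type ` L s"
    proof (rule subset_antisym[OF image_subsetI image_mono[OF L_T[OF s]]])
      fix K assume "K \<in> T s"
      then obtain H where "H \<in> L s" "isomorphic H K" unfolding T_def by blast
      then show "iso_type K \<in> iso_type ` L s" using iso_type_eq[of H K] graph[OF s] by auto
    qed
    then show "turan_Ex s n G = iso_type ` L s" unfolding turan_Ex_def ext[OF s] .
  qed
  show "turan_ex s n G = None" if s: "s > m"
  proof -
    have "K \<notin> turan_candidates s n G" for K
    proof
      assume K: "K \<in> turan_candidates s n G"
      then have K': "is_3graph K" "card (verts K) = n" "\<not> contains_copy K G"
        unfolding turan_candidates_def candidates_def by auto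
      obtain t H where t: "t \<in> {1..m}" "H \<in> L t" "contains_copy H K"
        using contained[OF K'] by blast
      then show False
        using K s subsetD[OF L_T[OF t(1)] t(2)] ext[OF t(1)]
        unfolding turan_candidates_def candidates_def by (auto dest!: bspec[of _ _ t])
    qed
    then show ?thesis unfolding turan_ex_def by auto
  qed
qed

section \<open>Cross-intersecting graphs\<close>

definition intersecting :: "'a set set \<Rightarrow> bool" where
  "intersecting E \<longleftrightarrow> (\<forall>e\<in>E. \<forall>f\<in>E. e \<inter> f \<noteq> {})"

lemma intersectingD: "intersecting E \<Longrightarrow> e \<in> E \<Longrightarrow> f \<in> E \<Longrightarrow> e \<inter> f \<noteq> {}"
  unfolding intersecting_def by blast

lemma verts_M2: "verts M2 = {..<6}"
  by (simp add: M2_def)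

lemma is_3graph_M2: "is_3graph M2"
  by (auto simp: is_3graph_def M2_def triples_def)

lemma M2_free_iff_intersecting:
  assumes "is_3graph G"
  shows "\<not> contains_copy G M2 \<longleftrightarrow> intersecting (edges G)"
proof
  assume free: "\<not> contains_copy G M2"
  show "intersecting (edges G)"
    unfolding intersecting_def
  proof (intro ballI notI)
    fix e f assume ef: "e \<in> edges G" "f \<in> edges G" "e \<inter> f = {}"
    obtain a b c where e: "e = {a, b, c}" "a \<noteq> b" "a \<noteq> c" "b \<noteq> c"
      using is_3graph_edge(2)[OF assms ef(1)] by (auto simp: card_3_iff)
    obtain p q r where f: "f = {p, q, r}" "p \<noteq> q" "p \<noteq> r" "q \<noteq> r"
      using is_3graph_edge(2)[OF assms ef(2)] by (auto simp: card_3_iff)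
    let ?vs = "[a, b, c, p, q, r]"
    have "distinct ?vs" using e f ef(3) by auto
    moreover have "set ?vs \<subseteq> verts G"
      using is_3graph_edge(1)[OF assms] ef e f by auto
    moreover have "(!) ?vs ` {..<6} \<subseteq> set ?vs" by (auto intro!: nth_mem simp del: set_simps)
    ultimately have V: "(!) ?vs ` verts M2 \<subseteq> verts G" "inj_on ((!) ?vs) (verts M2)"
      unfolding verts_M2 using subset_trans by (blast, auto intro: inj_on_nth)
    have "(!) ?vs ` m \<in> edges G" if "m \<in> edges M2" for m
      using that ef(1,2) e(1) f(1) by (auto simp: M2_def)
    then have "contains_copy G M2"
      by (rule contains_copyI[OF is_3graph_M2 V(2,1)])
    then show False using free by blast
  qed
next
  assume int: "intersecting (edges G)"
  show "\<not> contains_copy G M2"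
  proof
    assume "contains_copy G M2"
    then obtain \<phi> where \<phi>: "inj_on \<phi> {..<6}" "\<And>e. e \<in> edges M2 \<Longrightarrow> \<phi> ` e \<in> edges G"
      by (rule contains_copyE) (auto simp: M2_def)
    have "\<phi> ` ({0, 1, 2} \<inter> {3, 4, 5}) = \<phi> ` {0, 1, 2} \<inter> \<phi> ` {3, 4, 5}"
      by (rule inj_on_image_Int[OF \<phi>(1)]) auto
    then show False
      using intersectingD[OF int \<phi>(2) \<phi>(2), of "{0, 1, 2}" "{3, 4, 5}"] by (simp add: M2_def)
  qed
qed

section \<open>Embeddings obtained by numbering the vertices\<close>

lemma ex_bij_betw_labelling:
  assumes "finite V" "card V = n" "distinct vs" "set vs \<subseteq> V"
  shows "\<exists>\<phi>. bij_betw \<phi> V {..<n} \<and> (\<forall>i<length vs. \<phi> (vs ! i) = i)"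
proof -
  let ?k = "length vs"
  have k: "?k \<le> n" using assms card_mono distinct_card by metis
  have nth: "bij_betw ((!) vs) {..<?k} (set vs)"
    using bij_betw_nth[OF assms(3)] by simp
  let ?f = "inv_into {..<?k} ((!) vs)"
  have f: "bij_betw ?f (set vs) {..<?k}" using bij_betw_inv_into[OF nth] .
  have "card (V - set vs) = card {?k..<n}"
    using assms by (simp add: card_Diff_subset distinct_card)
  then obtain g where g: "bij_betw g (V - set vs) {?k..<n}"
    using assms(1) by (metis finite_Diff finite_same_card_bij finite_atLeastLessThan)
  let ?\<phi> = "\<lambda>v. if v \<in> set vs then ?f v else g v"
  have "bij_betw ?\<phi> (set vs) {..<?k}"
    using f by (rule bij_betw_cong[THEN iffD1, rotated]) simp
  moreover have "bij_betw ?\<phi> (V - set vs) {?k..<n}"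
    using g by (rule bij_betw_cong[THEN iffD1, rotated]) simp
  ultimately have "bij_betw ?\<phi> (set vs \<union> (V - set vs)) ({..<?k} \<union> {?k..<n})"
    by (rule bij_betw_combine) auto
  moreover have "set vs \<union> (V - set vs) = V" "{..<?k} \<union> {?k..<n} = {..<n}"
    using assms(4) k by auto
  moreover have "?\<phi> (vs ! i) = i" if "i < ?k" for i
    using inv_into_f_f[OF bij_betw_imp_inj_on[OF nth], of i] that by simp
  ultimately show ?thesis by (intro exI[of _ ?\<phi>]) simp
qed

text \<open>The vertices in \<open>vs\<close> get the first numbers, as in the definitions of the
  target graphs, and all others are numbered arbitrarily. The last premise of \<open>F\<close>
  supplies the part of membership in \<open>up n A\<close> that says the image is a triple below
  \<open>n\<close>, so that only \<open>A\<close> has to be found in it.\<close>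

lemma contains_copy_labelling:
  assumes "is_3graph (V, E)" "card V = n" "distinct vs" "set vs \<subseteq> V"
    and F: "\<And>\<phi> e. bij_betw \<phi> V {..<n} \<Longrightarrow> (\<And>i. i < length vs \<Longrightarrow> \<phi> (vs ! i) = i) \<Longrightarrow> e \<in> E \<Longrightarrow>
      \<phi> ` e \<in> triples {..<n} \<Longrightarrow> \<phi> ` e \<in> F"
  shows "contains_copy ({..<n}, F) (V, E)"
proof -
  have "finite V" using assms(1) by (simp add: is_3graph_def)
  then obtain \<phi> where \<phi>: "bij_betw \<phi> V {..<n}" "\<And>i. i < length vs \<Longrightarrow> \<phi> (vs ! i) = i"
    using ex_bij_betw_labelling[OF _ assms(2-4)] by blast
  have "\<phi> ` e \<in> F" if "e \<in> E" for e
  proof (rule F[OF \<phi> that])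
    have e: "e \<subseteq> V" "card e = 3" using is_3graph_edge[OF assms(1)] that by auto
    then show "\<phi> ` e \<in> triples {..<n}"
      using bij_betw_imp_surj_on[OF \<phi>(1)] inj_on_subset[OF bij_betw_imp_inj_on[OF \<phi>(1)]]
      by (auto simp: triples_def card_image)
  qed
  then show ?thesis
    using \<phi> assms(1) by (intro contains_copyI[of _ \<phi>]) (auto simp: bij_betw_def)
qed

lemma contains_copy_full_star:
  assumes "is_3graph (V, E)" "card V = n" "x \<in> V" "\<And>e. e \<in> E \<Longrightarrow> x \<in> e"
  shows "contains_copy (full_star n) (V, E)"
  unfolding full_star_def
  by (rule contains_copy_labelling[OF assms(1,2), of "[x]"]) (use assms in \<open>auto simp: up_def\<close>)

section \<open>Shapes of cross-intersecting pairs of graphs\<close>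

lemma pair_meets_path:
  assumes "card q = 2" "q \<inter> {a, b} \<noteq> {}" "q \<inter> {a, c} \<noteq> {}" "b \<noteq> c"
  shows "a \<in> q \<or> q = {b, c}"
proof -
  obtain u v where "q = {u, v}" "u \<noteq> v" using assms(1) by (auto simp: card_2_iff)
  then show ?thesis using assms(2-4) by auto
qed

lemma pair_meets_matching:
  assumes "card q = 2" "q \<inter> {a, b} \<noteq> {}" "q \<inter> {c, d} \<noteq> {}" "{a, b} \<inter> {c, d} = {}"
  shows "q \<in> {{a, c}, {a, d}, {b, c}, {b, d}}"
proof -
  obtain u v where "q = {u, v}" "u \<noteq> v" using assms(1) by (auto simp: card_2_iff)
  then show ?thesis using assms(2-4) by (auto simp: doubleton_eq_iff)
qed

lemma pair_in_triangle:
  assumes "card q = 2" "a \<in> q" "q \<inter> {b, c} \<noteq> {}" "b \<noteq> a" "c \<noteq> a"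
  shows "q \<in> {{a, b}, {a, c}, {b, c}}"
proof -
  obtain u where "q = {a, u}" using assms(1,2) by (auto simp: card_2_iff)
  then show ?thesis using assms(3-5) by auto
qed

text \<open>The shapes give, in this order, copies of \<open>H\<^sub>1\<close> to \<open>H\<^sub>6\<close> when \<open>A\<close> and \<open>B\<close> are the links
  of the two vertices of a cover.\<close>

inductive cross_shape :: "'a set set \<Rightarrow> 'a set set \<Rightarrow> bool" where
  single: "cross_shape {{a, b}} B" if "a \<noteq> b"
| star: "cross_shape A B" if "\<forall>p\<in>A \<union> B. a \<in> p"
| path: "cross_shape {{a, b}, {a, c}} B"
    if "distinct [a, b, c]" "\<forall>q\<in>B. a \<in> q \<or> q = {b, c}"
| triangle: "cross_shape A B"
    if "distinct [a, b, c]" "{{a, b}, {a, c}} \<subseteq> A" "A \<union> B \<subseteq> {{a, b}, {a, c}, {b, c}}"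
| path3: "cross_shape A B"
    if "distinct [a, b, c, d]" "{{a, b}, {c, d}} \<subseteq> A"
      "A \<subseteq> {{a, b}, {c, d}, {a, d}}" "B \<subseteq> {{a, c}, {b, d}, {a, d}}"
| cycle: "cross_shape A B"
    if "distinct [a, b, c, d]" "{{a, b}, {c, d}} \<subseteq> A"
      "A \<subseteq> {{a, b}, {c, d}, {a, d}, {b, c}}" "B \<subseteq> {{a, c}, {b, d}}"

text \<open>Two different edges of \<open>A\<close> with a common vertex a form a path, and an edge
  meeting both passes through a or joins the two ends.\<close>

lemma cross_shape_path:
  assumes "\<And>q. q \<in> B \<Longrightarrow> card q = 2" "\<And>p q. p \<in> A \<Longrightarrow> q \<in> B \<Longrightarrow> p \<inter> q \<noteq> {}"
    and A: "A = {p, q}" "p \<noteq> q" "p \<inter> q \<noteq> {}" "card p = 2" "card q = 2"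
  shows "cross_shape A B"
proof -
  obtain a where a: "a \<in> p" "a \<in> q" using A(3) by blast
  obtain b where b: "p = {a, b}" "b \<noteq> a" using A(4) a(1) by (auto simp: card_2_iff)
  obtain c where c: "q = {a, c}" "c \<noteq> a" using A(5) a(2) by (auto simp: card_2_iff)
  have bc: "b \<noteq> c" using A(2) b c by auto
  have "a \<in> r \<or> r = {b, c}" if "r \<in> B" for r
    using assms(2)[OF _ that] A(1) b c bc by (intro pair_meets_path assms(1)[OF that]) auto
  moreover have "distinct [a, b, c]" using b c bc by auto
  ultimately show ?thesis unfolding A(1) b(1) c(1) by (intro cross_shape.path) auto
qed

text \<open>The matching ab, cd in \<open>A\<close> and the matching ac, bd in \<open>B\<close>
  confine both graphs to four vertices, and only ad and bc remain undecided. These two are disjoint,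
  so they cannot lie on opposite sides. If one side has neither of them, the shape is
  \<open>cycle\<close>; otherwise one of them occurs on neither side and the shape is
  \<open>path3\<close>.\<close>

lemma cross_shape_matching:
  assumes A: "\<And>p. p \<in> A \<Longrightarrow> card p = 2" and B: "\<And>q. q \<in> B \<Longrightarrow> card q = 2"
    and cross: "\<And>p q. p \<in> A \<Longrightarrow> q \<in> B \<Longrightarrow> p \<inter> q \<noteq> {}"
    and abcd: "distinct [a, b, c, d]" "{a, b} \<in> A" "{c, d} \<in> A" "{a, c} \<in> B" "{b, d} \<in> B"
  shows "cross_shape A B \<or> cross_shape B A"
proof -
  have B4: "B \<subseteq> {{a, c}, {a, d}, {b, c}, {b, d}}"
  proof
    fix q assume "q \<in> B"
    then show "q \<in> {{a, c}, {a, d}, {b, c}, {b, d}}"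
      using cross[of "{a, b}" q] cross[of "{c, d}" q] abcd
      by (intro pair_meets_matching B) auto
  qed
  have A4: "A \<subseteq> {{a, b}, {a, d}, {c, b}, {c, d}}"
  proof
    fix p assume "p \<in> A"
    then show "p \<in> {{a, b}, {a, d}, {c, b}, {c, d}}"
      using cross[of p "{a, c}"] cross[of p "{b, d}"] abcd
      by (intro pair_meets_matching A) auto
  qed
  have disj: "{a, d} \<in> A \<Longrightarrow> {b, c} \<notin> B" "{b, c} \<in> A \<Longrightarrow> {a, d} \<notin> B"
    using cross[of "{a, d}" "{b, c}"] cross[of "{b, c}" "{a, d}"] abcd(1) by auto
  consider "{a, d} \<notin> B" "{b, c} \<notin> B" | "{a, d} \<notin> A" "{b, c} \<notin> A"
    | "{b, c} \<notin> A" "{b, c} \<notin> B" | "{a, d} \<notin> A" "{a, d} \<notin> B" using disj by blast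
  then show ?thesis
  proof cases
    case 1
    then have "cross_shape A B" using A4 B4 abcd by (intro cycle[of a b c d]) (auto simp: insert_commute)
    then show ?thesis by blast
  next
    case 2
    then have "cross_shape B A" using A4 B4 abcd by (intro cycle[of a c b d]) (auto simp: insert_commute)
    then show ?thesis by blast
  next
    case 3
    then have "cross_shape A B" using A4 B4 abcd by (intro path3[of a b c d]) (auto simp: insert_commute)
    then show ?thesis by blast
  next
    case 4
    then have "cross_shape A B" using A4 B4 abcd by (intro path3[of b a d c]) (auto simp: insert_commute)
    then show ?thesis by blast
  qed
qed

text \<open>For the four possible edges ac, ad, bc, bd between two disjoint edges: the excluded
  pairs are the disjoint ones ac, bd and ad, bc.\<close>

lemma two_of_four:
  assumes "B \<subseteq> {w, x, y, z}" "\<not> (w \<in> B \<and> z \<in> B)" "\<not> (x \<in> B \<and> y \<in> B)" "q \<in> B" "q' \<in> B" "q \<noteq> q'"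
  shows "B = {q, q'}"
  using assms by blast

text \<open>Disjoint edges ab, cd of \<open>A\<close> leave only ac, ad, bc, bd for
  \<open>B\<close>. If \<open>B\<close> contains two disjoint ones of these, there is a matching on
  both sides; otherwise \<open>B\<close> consists of two edges sharing a vertex, and the path shape
  applies with the sides exchanged.\<close>

lemma cross_shape_disjoint_pair:
  assumes A: "\<And>p. p \<in> A \<Longrightarrow> card p = 2" and B: "\<And>q. q \<in> B \<Longrightarrow> card q = 2"
    and cross: "\<And>p q. p \<in> A \<Longrightarrow> q \<in> B \<Longrightarrow> p \<inter> q \<noteq> {}"
    and p: "p \<in> A" "p' \<in> A" "p \<inter> p' = {}" and q: "q \<in> B" "q' \<in> B" "q \<noteq> q'"
  shows "cross_shape A B \<or> cross_shape B A"
proof -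
  obtain a b where ab: "p = {a, b}" "a \<noteq> b" using A[OF p(1)] by (auto simp: card_2_iff)
  obtain c d where cd: "p' = {c, d}" "c \<noteq> d" using A[OF p(2)] by (auto simp: card_2_iff)
  have dist: "distinct [a, b, c, d]" using ab cd p(3) by auto
  have B4: "B \<subseteq> {{a, c}, {a, d}, {b, c}, {b, d}}"
  proof
    fix r assume "r \<in> B"
    then show "r \<in> {{a, c}, {a, d}, {b, c}, {b, d}}"
      using cross[OF p(1), of r] cross[OF p(2), of r] ab cd p(3)
      by (intro pair_meets_matching B) auto
  qed
  consider "{a, c} \<in> B" "{b, d} \<in> B" | "{a, d} \<in> B" "{b, c} \<in> B" | "q \<inter> q' \<noteq> {}" "B = {q, q'}"
  proof -
    assume 1: "{a, c} \<in> B \<Longrightarrow> {b, d} \<in> B \<Longrightarrow> thesis" and 2: "{a, d} \<in> B \<Longrightarrow> {b, c} \<in> B \<Longrightarrow> thesis"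
      and 3: "q \<inter> q' \<noteq> {} \<Longrightarrow> B = {q, q'} \<Longrightarrow> thesis"
    show thesis
    proof (rule ccontr)
      assume "\<not> thesis"
      then have no: "\<not> ({a, c} \<in> B \<and> {b, d} \<in> B)" "\<not> ({a, d} \<in> B \<and> {b, c} \<in> B)"
        using 1 2 by blast+
      have "q \<inter> q' \<noteq> {}" using q B4 no by auto
      moreover have "B = {q, q'}" by (rule two_of_four[OF B4 no q])
      ultimately show False using 3 \<open>\<not> thesis\<close> by blast
    qed
  qed
  then show ?thesis
  proof cases
    case 1
    show ?thesis
      by (rule cross_shape_matching[OF A B cross, where a = a and b = b and c = c and d = d])
        (use 1 ab cd p dist in auto)
  next
    case 2
    show ?thesis
      by (rule cross_shape_matching[OF A B cross, where a = a and b = b and c = d and d = c])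
        (use 2 ab cd p dist in \<open>auto simp: insert_commute\<close>)
  next
    case 3
    then have "cross_shape B A"
      using cross B q by (intro cross_shape_path[OF A]) (auto simp: Int_commute)
    then show ?thesis by blast
  qed
qed

text \<open>Once one-edge sides and disjoint edges within a side are settled, both sides are
  intersecting. Then either \<open>A\<close> is a path of two edges, or it has three pairwise
  meeting edges, which form a triangle or have a common vertex; in both of the latter cases
  \<open>A\<close> dictates the shape of \<open>B\<close>.\<close>

lemma cross_intersecting_graphs:
  assumes A: "\<And>p. p \<in> A \<Longrightarrow> card p = 2" and B: "\<And>q. q \<in> B \<Longrightarrow> card q = 2"
    and cross: "\<And>p q. p \<in> A \<Longrightarrow> q \<in> B \<Longrightarrow> p \<inter> q \<noteq> {}"
    and "A \<noteq> {}" "B \<noteq> {}"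
  shows "cross_shape A B \<or> cross_shape B A"
proof -
  have cross': "p \<inter> q \<noteq> {}" if "p \<in> B" "q \<in> A" for p q using cross[OF that(2,1)] by blast
  have single: "cross_shape P Q" if "P = {p}" "card p = 2" for P Q :: "'a set set" and p
    using that cross_shape.single by (auto simp: card_2_iff)
  obtain p q where pq: "p \<in> A" "q \<in> B" using assms(4,5) by blast
  show ?thesis
  proof (cases "A = {p} \<or> B = {q}")
    case True
    then show ?thesis using single A B pq by blast
  next
    case False
    then obtain p' q' where p': "p' \<in> A" "p \<noteq> p'" and q': "q' \<in> B" "q \<noteq> q'" using pq by blast
    show ?thesis
    proof (cases "intersecting A \<and> intersecting B")
      case False
      then consider r s where "r \<in> A" "s \<in> A" "r \<inter> s = {}" | r s where "r \<in> B" "s \<in> B" "r \<inter> s = {}"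
        unfolding intersecting_def by blast
      then show ?thesis
      proof cases
        case 1
        then show ?thesis using cross_shape_disjoint_pair[OF A B cross _ _ _ pq(2) q'] by blast
      next
        case 2
        then show ?thesis using cross_shape_disjoint_pair[OF B A cross' _ _ _ pq(1) p'] by blast
      qed
    next
      case True
      then have int: "p \<inter> p' \<noteq> {}" using pq p' unfolding intersecting_def by blast
      show ?thesis
      proof (cases "A = {p, p'}")
        case True
        then show ?thesis using cross_shape_path[OF B cross True p'(2) int] A pq p' by blast
      next
        case False
        then obtain r where r: "r \<in> A" "r \<noteq> p" "r \<noteq> p'" using pq p' by blast
        obtain a where a: "a \<in> p" "a \<in> p'" using int by blast
        obtain b where b: "p = {a, b}" "b \<noteq> a" using A[OF pq(1)] a(1) by (auto simp: card_2_iff)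
        obtain c where c: "p' = {a, c}" "c \<noteq> a" using A[OF p'(1)] a(2) by (auto simp: card_2_iff)
        have bc: "b \<noteq> c" using p' b c by auto
        have meets: "s \<inter> t \<noteq> {}" if "s \<in> A \<union> B" "t \<in> A" for s t
        proof (cases "s \<in> A")
          case True
          then show ?thesis using intersectingD[of A s t] that(2) \<open>intersecting A \<and> intersecting B\<close> by simp
        next
          case False
          then show ?thesis using cross'[of s t] that by simp
        qed
        \<comment> \<open>Edges of \<open>A\<close> and \<open>B\<close> can be treated alike, since
          both kinds meet every edge of \<open>A\<close>.\<close>
        have star: "a \<in> s \<or> s = {b, c}" if "s \<in> A \<union> B" for s
        proof (rule pair_meets_path)
          show "card s = 2" using A B that by auto
          show "s \<inter> {a, b} \<noteq> {}" "s \<inter> {a, c} \<noteq> {}"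
            using meets[OF that pq(1)] meets[OF that p'(1)] b(1) c(1) by simp_all
        qed (rule bc)
        show ?thesis
        proof (cases "{b, c} \<in> A")
          case True
          have "s \<in> {{a, b}, {a, c}, {b, c}}" if "s \<in> A \<union> B" for s
          proof -
            have s: "card s = 2" using A B that by auto
            show ?thesis
            proof (cases "a \<in> s")
              case True
              then show ?thesis
                using pair_in_triangle[OF s _ meets[OF that \<open>{b, c} \<in> A\<close>] b(2) c(2)] by simp
            next
              case False
              then show ?thesis using star[OF that] by simp
            qed
          qed
          then have "A \<union> B \<subseteq> {{a, b}, {a, c}, {b, c}}" by (rule subsetI)
          moreover have "{{a, b}, {a, c}} \<subseteq> A" using b c pq p' by simp
          moreover have "distinct [a, b, c]" using b c bc by auto
          ultimately have "cross_shape A B" by (intro triangle)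
          then show ?thesis by blast
        next
          case False
          then have "a \<in> r" using star r by blast
          obtain d where d: "r = {a, d}" "d \<noteq> a"
            using A[OF r(1)] \<open>a \<in> r\<close> by (auto simp: card_2_iff)
          \<comment> \<open>The third edge {a, d} of \<open>A\<close> misses {b, c}, so the only
            edge of \<open>B\<close> that could avoid a is excluded.\<close>
          have "{b, c} \<notin> B" using cross[OF r(1), of "{b, c}"] r d b c by auto
          then have "\<forall>s\<in>A \<union> B. a \<in> s" using star False by blast
          then have "cross_shape A B" by (rule cross_shape.star)
          then show ?thesis by blast
        qed
      qed
    qed
  qed
qed

section \<open>Families with a cover of size two\<close>

lemma mem_up: "f \<in> up n A \<longleftrightarrow> f \<in> triples {..<n} \<and> A \<subseteq> f"
  by (auto simp: up_def)

lemma contains_copy_cross_shape: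
  assumes G: "is_3graph (V, E)" "card V = n" and xy: "x \<in> V" "y \<in> V" "x \<noteq> y"
    and A: "A \<subseteq> Pow (V - {x, y})" "{} \<notin> A" "A \<noteq> {}"
    and cross: "\<And>p q. p \<in> A \<Longrightarrow> q \<in> B \<Longrightarrow> p \<inter> q \<noteq> {}"
    and E: "\<And>e. e \<in> E \<Longrightarrow> {x, y} \<subseteq> e \<or> (\<exists>p\<in>A. e = insert x p) \<or> (\<exists>q\<in>B. e = insert y q)"
    and shape: "cross_shape A B"
  shows "\<exists>H\<in>{H1 n, H2 n, H3 n, H4 n, H5 n, H6 n}. contains_copy H (V, E)"
  using shape
proof cases
  case (single a b)
  have "contains_copy (H1 n) (V, E)"
    unfolding H1_def Let_def
  \<comment> \<open>The centre 0 of \<open>H1\<close> is \<open>y\<close>, not \<open>x\<close>: as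
    \<open>A\<close> is the single pair {a, b}, the only possible edge without \<open>y\<close> is
    {x, a, b}. The roles are exchanged in the same way for \<open>H3\<close>.\<close>
  proof (rule contains_copy_labelling[OF G, of "[y, x, a, b]"])
    fix \<phi> e
    assume \<phi>: "\<And>i. i < length [y, x, a, b] \<Longrightarrow> \<phi> ([y, x, a, b] ! i) = i"
      and e: "e \<in> E" "\<phi> ` e \<in> triples {..<n}"
    have [simp]: "\<phi> y = 0" "\<phi> x = 1" "\<phi> a = 2" "\<phi> b = 3"
      using \<phi>[of 0] \<phi>[of 1] \<phi>[of 2] \<phi>[of 3] by simp_all
    have mem: "0 \<in> \<phi> ` e" if "y \<in> e" using imageI[OF that, of \<phi>] by simp
    have mem1: "1 \<in> \<phi> ` e" if "x \<in> e" using imageI[OF that, of \<phi>] by simp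
    have mem2: "2 \<in> \<phi> ` e" if "a \<in> e" using imageI[OF that, of \<phi>] by simp
    have mem3: "3 \<in> \<phi> ` e" if "b \<in> e" using imageI[OF that, of \<phi>] by simp
    consider "x \<in> e" "y \<in> e" | "e = {x, a, b}" | "y \<in> e" "a \<in> e" | "y \<in> e" "b \<in> e"
      using E[OF e(1)] cross[of "{a, b}"] single(1) by blast
    then show "\<phi> ` e \<in> up n {0, 1} \<union> up n {0, 2} \<union> up n {0, 3} \<union> {{1, 2, 3}}"
      by cases (use e(2) mem mem1 mem2 mem3 in \<open>simp_all add: mem_up\<close>)
  qed (use single A xy in auto)
  then show ?thesis by blast
next
  case (star a)
  obtain p where "p \<in> A" using A(3) by blast
  then have a: "a \<in> V - {x, y}" using star A(1) by blast
  have "contains_copy (H2 n) (V, E)"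
    unfolding H2_def Let_def
  proof (rule contains_copy_labelling[OF G, of "[x, y, a]"])
    fix \<phi> e
    assume \<phi>: "\<And>i. i < length [x, y, a] \<Longrightarrow> \<phi> ([x, y, a] ! i) = i"
      and e: "e \<in> E" "\<phi> ` e \<in> triples {..<n}"
    have [simp]: "\<phi> x = 0" "\<phi> y = 1" "\<phi> a = 2"
      using \<phi>[of 0] \<phi>[of 1] \<phi>[of 2] by simp_all
    have mem: "0 \<in> \<phi> ` e" if "x \<in> e" using imageI[OF that, of \<phi>] by simp
    have mem1: "1 \<in> \<phi> ` e" if "y \<in> e" using imageI[OF that, of \<phi>] by simp
    have mem2: "2 \<in> \<phi> ` e" if "a \<in> e" using imageI[OF that, of \<phi>] by simp
    consider "x \<in> e" "y \<in> e" | "x \<in> e" "a \<in> e" | "y \<in> e" "a \<in> e"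
      using E[OF e(1)] star by blast
    then show "\<phi> ` e \<in> up n {0, 1} \<union> up n {0, 2} \<union> up n {1, 2}"
      by cases (use e(2) mem mem1 mem2 in \<open>simp_all add: mem_up\<close>)
  qed (use a xy in auto)
  then show ?thesis by blast
next
  case (path a b c)
  have "contains_copy (H3 n) (V, E)"
    unfolding H3_def Let_def
  proof (rule contains_copy_labelling[OF G, of "[y, x, a, b, c]"])
    fix \<phi> e
    assume \<phi>: "\<And>i. i < length [y, x, a, b, c] \<Longrightarrow> \<phi> ([y, x, a, b, c] ! i) = i"
      and e: "e \<in> E" "\<phi> ` e \<in> triples {..<n}"
    have [simp]: "\<phi> y = 0" "\<phi> x = 1" "\<phi> a = 2" "\<phi> b = 3" "\<phi> c = 4"
      using \<phi>[of 0] \<phi>[of 1] \<phi>[of 2] \<phi>[of 3] \<phi>[of 4] by simp_all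
    have mem: "0 \<in> \<phi> ` e" if "y \<in> e" using imageI[OF that, of \<phi>] by simp
    have mem1: "1 \<in> \<phi> ` e" if "x \<in> e" using imageI[OF that, of \<phi>] by simp
    have mem2: "2 \<in> \<phi> ` e" if "a \<in> e" using imageI[OF that, of \<phi>] by simp
    consider "x \<in> e" "y \<in> e" | "y \<in> e" "a \<in> e" | "e = {y, b, c}" | "e = {x, a, b}" | "e = {x, a, c}"
      using E[OF e(1)] path(1,3) by blast
    then show "\<phi> ` e \<in> up n {0, 1} \<union> up n {0, 2} \<union> {{0, 3, 4}, {1, 2, 4}, {1, 2, 3}}"
      by cases (use e(2) mem mem1 mem2 in \<open>simp_all add: mem_up\<close>)
  qed (use path A xy in auto)
  then show ?thesis by blast
next
  case (triangle a b c)
  have "contains_copy (H4 n) (V, E)"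
    unfolding H4_def Let_def
  proof (rule contains_copy_labelling[OF G, of "[x, y, a, b, c]"])
    fix \<phi> e
    assume \<phi>: "\<And>i. i < length [x, y, a, b, c] \<Longrightarrow> \<phi> ([x, y, a, b, c] ! i) = i"
      and e: "e \<in> E" "\<phi> ` e \<in> triples {..<n}"
    have [simp]: "\<phi> x = 0" "\<phi> y = 1" "\<phi> a = 2" "\<phi> b = 3" "\<phi> c = 4"
      using \<phi>[of 0] \<phi>[of 1] \<phi>[of 2] \<phi>[of 3] \<phi>[of 4] by simp_all
    have mem: "0 \<in> \<phi> ` e" if "x \<in> e" using imageI[OF that, of \<phi>] by simp
    have mem1: "1 \<in> \<phi> ` e" if "y \<in> e" using imageI[OF that, of \<phi>] by simp
    consider "x \<in> e" "y \<in> e" | p where "p \<in> A" "e = insert x p" | p where "p \<in> B" "e = insert y p"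
      using E[OF e(1)] by blast
    then show "\<phi> ` e \<in> up n {0, 1} \<union> {{0, 3, 2}, {0, 4, 2}, {0, 3, 4}, {1, 2, 4}, {1, 2, 3}, {1, 3, 4}}"
    proof cases
      case 1
      then show ?thesis using e(2) mem mem1 by (simp add: mem_up)
    next
      case (2 p)
      then have "p = {a, b} \<or> p = {a, c} \<or> p = {b, c}" using subsetD[OF triangle(3), of p] by simp
      then show ?thesis unfolding 2(2) by (elim disjE) (simp_all add: insert_commute)
    next
      case (3 p)
      then have "p = {a, b} \<or> p = {a, c} \<or> p = {b, c}" using subsetD[OF triangle(3), of p] by simp
      then show ?thesis unfolding 3(2) by (elim disjE) (simp_all add: insert_commute)
    qed
  qed (use triangle A xy in auto)
  then show ?thesis by blast
next
  case (path3 a b c d)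
  have "contains_copy (H5 n) (V, E)"
    unfolding H5_def Let_def
  \<comment> \<open>In the names of the definition of \<open>H5\<close>, the vertices b, a, d, c are
    z, v, w, u. The same order fits \<open>H6\<close> below.\<close>
  proof (rule contains_copy_labelling[OF G, of "[x, y, b, a, d, c]"])
    fix \<phi> e
    assume \<phi>: "\<And>i. i < length [x, y, b, a, d, c] \<Longrightarrow> \<phi> ([x, y, b, a, d, c] ! i) = i"
      and e: "e \<in> E" "\<phi> ` e \<in> triples {..<n}"
    have [simp]: "\<phi> x = 0" "\<phi> y = 1" "\<phi> b = 2" "\<phi> a = 3" "\<phi> d = 4" "\<phi> c = 5"
      using \<phi>[of 0] \<phi>[of 1] \<phi>[of 2] \<phi>[of 3] \<phi>[of 4] \<phi>[of 5] by simp_all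
    have mem: "0 \<in> \<phi> ` e" if "x \<in> e" using imageI[OF that, of \<phi>] by simp
    have mem1: "1 \<in> \<phi> ` e" if "y \<in> e" using imageI[OF that, of \<phi>] by simp
    consider "x \<in> e" "y \<in> e" | p where "p \<in> A" "e = insert x p" | p where "p \<in> B" "e = insert y p"
      using E[OF e(1)] by blast
    then show "\<phi> ` e \<in> up n {0, 1} \<union> {{0, 3, 2}, {0, 4, 5}, {0, 3, 4}, {1, 2, 4}, {1, 5, 3}, {1, 3, 4}}"
    proof cases
      case 1
      then show ?thesis using e(2) mem mem1 by (simp add: mem_up)
    next
      case (2 p)
      then have "p = {a, b} \<or> p = {c, d} \<or> p = {a, d}" using subsetD[OF path3(3), of p] by simp
      then show ?thesis unfolding 2(2) by (elim disjE) (simp_all add: insert_commute)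
    next
      case (3 p)
      then have "p = {a, c} \<or> p = {b, d} \<or> p = {a, d}" using subsetD[OF path3(4), of p] by simp
      then show ?thesis unfolding 3(2) by (elim disjE) (simp_all add: insert_commute)
    qed
  qed (use path3 A xy in auto)
  then show ?thesis by blast
next
  case (cycle a b c d)
  have "contains_copy (H6 n) (V, E)"
    unfolding H6_def Let_def
  proof (rule contains_copy_labelling[OF G, of "[x, y, b, a, d, c]"])
    fix \<phi> e
    assume \<phi>: "\<And>i. i < length [x, y, b, a, d, c] \<Longrightarrow> \<phi> ([x, y, b, a, d, c] ! i) = i"
      and e: "e \<in> E" "\<phi> ` e \<in> triples {..<n}"
    have [simp]: "\<phi> x = 0" "\<phi> y = 1" "\<phi> b = 2" "\<phi> a = 3" "\<phi> d = 4" "\<phi> c = 5"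
      using \<phi>[of 0] \<phi>[of 1] \<phi>[of 2] \<phi>[of 3] \<phi>[of 4] \<phi>[of 5] by simp_all
    have mem: "0 \<in> \<phi> ` e" if "x \<in> e" using imageI[OF that, of \<phi>] by simp
    have mem1: "1 \<in> \<phi> ` e" if "y \<in> e" using imageI[OF that, of \<phi>] by simp
    consider "x \<in> e" "y \<in> e" | p where "p \<in> A" "e = insert x p" | p where "p \<in> B" "e = insert y p"
      using E[OF e(1)] by blast
    then show "\<phi> ` e \<in> up n {0, 1} \<union> {{0, 3, 2}, {0, 4, 5}, {0, 3, 4}, {1, 2, 4}, {1, 5, 3}, {0, 2, 5}}"
    proof cases
      case 1
      then show ?thesis using e(2) mem mem1 by (simp add: mem_up)
    next
      case (2 p)
      then have "p = {a, b} \<or> p = {c, d} \<or> p = {a, d} \<or> p = {b, c}" using subsetD[OF cycle(3), of p] by simp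
      then show ?thesis unfolding 2(2) by (elim disjE) (simp_all add: insert_commute)
    next
      case (3 p)
      then have "p = {a, c} \<or> p = {b, d}" using subsetD[OF cycle(4), of p] by simp
      then show ?thesis unfolding 3(2) by (elim disjE) (simp_all add: insert_commute)
    qed
  qed (use cycle A xy in auto)
  then show ?thesis by blast
qed

text \<open>Edges containing both \<open>x\<close> and \<open>y\<close> meet every edge and go into
  the part \<open>up n {x, y}\<close>. An edge through \<open>x\<close> only and an edge through
  \<open>y\<close> only must meet outside {x, y}, so the two links cross-intersect; both are
  nonempty because no single vertex is a cover.\<close>

lemma two_cover_contained:
  assumes G: "is_3graph (V, E)" "card V = n" and int: "intersecting E"
    and no_cover: "\<And>v. \<exists>e\<in>E. v \<notin> e" and cover: "\<And>e. e \<in> E \<Longrightarrow> x \<in> e \<or> y \<in> e"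
  shows "\<exists>H\<in>{H1 n, H2 n, H3 n, H4 n, H5 n, H6 n}. contains_copy H (V, E)"
proof -
  define link where "link x y = {p. x \<notin> p \<and> y \<notin> p \<and> insert x p \<in> E}" for x y
  have E: "e \<subseteq> V" "card e = 3" "finite e" if "e \<in> E" for e
    using is_3graph_edge[OF G(1)] that by auto
  obtain f g where f: "f \<in> E" "x \<notin> f" and g: "g \<in> E" "y \<notin> g" using no_cover by blast
  then have fg: "y \<in> f" "x \<in> g" using cover by blast+
  have xy: "x \<in> V" "y \<in> V" "x \<noteq> y" using E(1) f g fg by auto
  have link: "{x, y} \<subseteq> e \<or> (\<exists>p\<in>link x y. e = insert x p) \<or> (\<exists>q\<in>link y x. e = insert y q)"
    if "e \<in> E" for e
  proof -
    have "e - {x} \<in> link x y" "e = insert x (e - {x})" if "x \<in> e" "y \<notin> e"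
      using that \<open>e \<in> E\<close> by (auto simp: link_def insert_absorb)
    moreover have "e - {y} \<in> link y x" "e = insert y (e - {y})" if "y \<in> e" "x \<notin> e"
      using that \<open>e \<in> E\<close> by (auto simp: link_def insert_absorb)
    ultimately show ?thesis using cover[OF that] by blast
  qed
  have card_link: "card p = 2" if "p \<in> link u v" for p u v
    using that E(2,3)[of "insert u p"] by (auto simp: link_def)
  have link_sub: "link u v \<subseteq> Pow (V - {u, v})" for u v
    using E(1) by (auto simp: link_def)
  have cross: "p \<inter> q \<noteq> {}" if "p \<in> link x y" "q \<in> link y x" for p q
    using intersectingD[OF int, of "insert x p" "insert y q"] that xy(3) by (auto simp: link_def)
  have "g - {x} \<in> link x y" "f - {y} \<in> link y x"
    using f g fg by (auto simp: link_def insert_absorb)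
  then have ne: "link x y \<noteq> {}" "link y x \<noteq> {}" by blast+
  have nonempty: "{} \<notin> link u v" for u v using card_link[of "{}"] by fastforce
  consider "cross_shape (link x y) (link y x)" | "cross_shape (link y x) (link x y)"
    using cross_intersecting_graphs[OF card_link[where u = x and v = y]
        card_link[where u = y and v = x] cross ne] by blast
  then show ?thesis
  proof cases
    case 1
    show ?thesis
      by (rule contains_copy_cross_shape[OF G xy link_sub nonempty ne(1) cross link 1])
  next
    case 2
    have link': "{y, x} \<subseteq> e \<or> (\<exists>p\<in>link y x. e = insert y p) \<or> (\<exists>q\<in>link x y. e = insert x q)"
      if "e \<in> E" for e using link[OF that] by blast
    have cross': "p \<inter> q \<noteq> {}" if "p \<in> link y x" "q \<in> link x y" for p q
      using cross[OF that(2,1)] by blast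
    show ?thesis
      by (rule contains_copy_cross_shape[OF G xy(2,1) xy(3)[symmetric] link_sub nonempty ne(2)
            cross' link' 2])
  qed
qed

section \<open>Families without a cover of size two\<close>

text \<open>From here on the vertices \<open>x\<^sub>1, x\<^sub>2, x\<^sub>3, y\<^sub>1, y\<^sub>2, y\<^sub>3, z\<close> are numbered \<open>0, \<dots>, 6\<close>, and edges are
  lists of numbers.\<close>

definition triangle_edges :: "nat list list" where
  "triangle_edges = [[0,1,5], [0,2,4], [1,2,3]]"

definition edges_F7 :: "nat list list" where
  "edges_F7 = triangle_edges @
     [[0,3,6], [1,4,6], [2,5,6], [3,4,5]]"

definition edges_F10 :: "nat list list" where
  "edges_F10 = triangle_edges @
     [[0,1,2], [0,1,6], [0,2,6], [1,2,6], [0,3,6], [1,4,6], [2,5,6]]"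

definition edges_H7 :: "nat list list" where
  "edges_H7 = triangle_edges @
     [[0,1,2], [0,3,4], [0,3,5], [1,3,4], [1,4,5], [2,3,5], [2,4,5]]"

definition edges_H8 :: "nat list list" where
  "edges_H8 = triangle_edges @
     [[3,4,5], [0,3,4], [0,3,5], [1,3,4], [1,4,5], [2,3,5], [2,4,5]]"

definition edges_H9 :: "nat list list" where
  "edges_H9 = triangle_edges @
     [[3,4,5], [0,1,4], [0,2,5], [0,1,3], [1,2,5], [0,2,3], [1,2,4]]"

definition edges_H10 :: "nat list list" where
  "edges_H10 = triangle_edges @
     [[3,4,5], [0,3,5], [1,3,4], [1,4,5], [2,3,5], [2,4,5], [1,2,5]]"

definition edges_H11 :: "nat list list" where
  "edges_H11 = triangle_edges @
     [[3,4,5], [1,3,4], [1,4,5], [2,3,5], [2,4,5], [1,2,5], [1,2,4]]"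

definition ten_edge_lists :: "nat list list list" where
  "ten_edge_lists = [edges_F10, edges_H7, edges_H8, edges_H9, edges_H10, edges_H11]"

definition seven_vertex_edges :: "nat list list list" where
  "seven_vertex_edges = edges_F7 # ten_edge_lists"

definition graph_on :: "nat \<Rightarrow> nat list list \<Rightarrow> nat hypergraph" where
  "graph_on n L = ({..<n}, set ` set L)"

text \<open>A certificate is a decision tree: \<open>Branch e\<close> separates the families without the edge \<open>e\<close>
  from those with it, and a leaf is reached when all edges that are still possible have a common
  cover of size two or embed into one of the target families by a permutation of \<open>{..<7}\<close>.
  The certificate below was found by computer search.\<close>

datatype certificate =
    Cover nat nat
  | Embed "nat list list" "nat list"
  | Branch "nat list" certificate certificate

text \<open>\<open>L\<close> collects the edges that are still possible. Accepting \<open>e\<close>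
  discards those disjoint from it, and rejecting \<open>e\<close> discards \<open>e\<close> alone. A
  \<open>Cover\<close> leaf is a contradiction, as the family has no cover of size two; in an
  \<open>Embed\<close> leaf the list \<open>p\<close> is the permutation sending i to
  \<open>p ! i\<close>.\<close>

fun valid :: "certificate \<Rightarrow> nat list list \<Rightarrow> bool" where
  "valid (Cover a b) L \<longleftrightarrow> list_all (\<lambda>e. a \<in> set e \<or> b \<in> set e) L"
| "valid (Embed T p) L \<longleftrightarrow> T \<in> set seven_vertex_edges \<and> distinct p \<and> length p = 7 \<and>
     list_all (\<lambda>i. i < 7) p \<and> list_all (\<lambda>e. set (map ((!) p) e) \<in> set (map set T)) L"
| "valid (Branch e c d) L \<longleftrightarrow> valid c (filter (\<lambda>f. f \<noteq> e) L) \<and>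
     valid d (filter (\<lambda>f. list_ex (\<lambda>v. v \<in> set f) e) L)"

text \<open>\<open>E\<close> stays fixed while \<open>L\<close> shrinks along a branch of the tree;
  the invariant is that every edge of \<open>E\<close> is still listed in \<open>L\<close>.\<close>

lemma valid_sound:
  assumes "valid c L" "E \<subseteq> set ` set L" "intersecting E" "\<And>a b. \<exists>e\<in>E. a \<notin> e \<and> b \<notin> e"
  shows "\<exists>T\<in>set seven_vertex_edges. \<exists>p. distinct p \<and> length p = 7 \<and> set p \<subseteq> {..<7} \<and>
    (\<forall>e\<in>E. (!) p ` e \<in> set ` set T)"
  using assms(1,2)
proof (induction c arbitrary: L)
  case (Cover a b)
  obtain e where "e \<in> E" "a \<notin> e" "b \<notin> e" using assms(4) by blast
  then show ?case using Cover by (auto simp: list_all_iff)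
next
  case (Embed T p)
  have "(!) p ` e \<in> set ` set T" if "e \<in> E" for e
    using Embed that by (auto simp: list_all_iff)
  then show ?case using Embed(1) by (intro bexI[of _ T] exI[of _ p]) (auto simp: list_all_iff)
next
  case (Branch e c d)
  show ?case
  proof (cases "set e \<in> E")
    case True
    have "E \<subseteq> set ` set (filter (\<lambda>f. list_ex (\<lambda>v. v \<in> set f) e) L)"
    proof
      fix g assume g: "g \<in> E"
      then obtain f where "f \<in> set L" "g = set f" using Branch.prems(2) by blast
      moreover have "set e \<inter> g \<noteq> {}" using intersectingD[OF assms(3) True g] .
      ultimately show "g \<in> set ` set (filter (\<lambda>f. list_ex (\<lambda>v. v \<in> set f) e) L)"
        by (auto simp: list_ex_iff)
    qed
    moreover have "valid d (filter (\<lambda>f. list_ex (\<lambda>v. v \<in> set f) e) L)" using Branch.prems(1) by simp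
    ultimately show ?thesis using Branch.IH(2) by blast
  next
    case False
    then have "E \<subseteq> set ` set (filter (\<lambda>f. f \<noteq> e) L)" using Branch.prems(2) by auto
    moreover have "valid c (filter (\<lambda>f. f \<noteq> e) L)" using Branch.prems(1) by simp
    ultimately show ?thesis using Branch.IH(1) by blast
  qed
qed

text \<open>The root of the search. Each triple appears once and in increasing order, so that the
  list comparison in \<open>valid\<close> deletes exactly the rejected triple.\<close>

definition triangle_transversals :: "nat list list" where
  "triangle_transversals = [[a, b, c]. a \<leftarrow> [0..<7], b \<leftarrow> [Suc a..<7], c \<leftarrow> [Suc b..<7],
     list_all (\<lambda>e. a \<in> set e \<or> b \<in> set e \<or> c \<in> set e) triangle_edges]"

definition triangle_certificate :: certificate where
  "triangle_certificate =
     Branch [1,4,6] (Branch [2,5,6] (Branch [3,4,5] (Branch [0,3,6] (Branch [0,1,6] (Branch [0,3,4]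
     (Branch [0,3,5] (Cover 1 2) (Branch [1,3,4] (Branch [1,4,5] (Cover 0 2) (Branch [0,1,3]
     (Branch [0,1,4] (Cover 2 5) (Embed edges_H11 [1,2,4,0,3,5,6])) (Branch [0,1,4]
     (Embed edges_H11 [1,2,5,3,0,4,6]) (Cover 0 1)))) (Branch [0,1,3] (Branch [0,1,4] (Branch [0,2,3]
     (Embed edges_H8 [0,3,4,1,2,5,6]) (Embed edges_H10 [1,2,5,4,0,3,6])) (Branch [0,2,3]
     (Embed edges_H10 [2,5,1,0,3,4,6]) (Embed edges_H8 [3,4,5,2,0,1,6]))) (Branch [0,1,4]
     (Branch [0,2,3] (Embed edges_H10 [2,5,4,1,0,3,6]) (Embed edges_H11 [1,2,5,4,0,3,6]))
     (Cover 0 1))))) (Branch [1,3,4] (Branch [1,4,5] (Cover 0 2) (Branch [0,1,3] (Branch [0,1,4]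
     (Branch [0,3,5] (Embed edges_H10 [2,1,5,0,4,3,6]) (Embed edges_H8 [3,0,4,2,1,5,6]))
     (Branch [0,3,5] (Embed edges_H11 [1,2,4,0,5,3,6]) (Embed edges_H10 [5,2,4,0,1,3,6])))
     (Branch [0,1,4] (Branch [0,3,5] (Embed edges_H8 [3,4,5,1,2,0,6])
     (Embed edges_H10 [5,2,1,3,0,4,6])) (Cover 0 1)))) (Branch [0,1,3] (Branch [0,1,4]
     (Branch [0,2,3] (Branch [0,3,5] (Embed edges_H8 [0,4,3,1,5,2,6])
     (Embed edges_H7 [0,1,2,3,4,5,6])) (Branch [0,3,5] (Embed edges_H10 [2,4,5,1,3,0,6])
     (Embed edges_H8 [3,1,4,5,0,2,6]))) (Branch [0,2,3] (Branch [0,3,5] (Cover 1 4)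
     (Embed edges_H8 [3,4,0,2,5,1,6])) (Branch [0,3,5] (Embed edges_H11 [1,5,2,3,4,0,6])
     (Embed edges_H10 [5,1,2,3,4,0,6])))) (Branch [0,1,4] (Branch [0,2,3] (Branch [0,3,5]
     (Embed edges_H10 [1,5,2,4,3,0,6]) (Embed edges_H8 [3,4,1,5,2,0,6])) (Branch [0,3,5]
     (Embed edges_H11 [1,5,2,4,3,0,6]) (Cover 0 3))) (Cover 0 1))))) (Cover 0 1)) (Branch [1,2,6]
     (Cover 0 3) (Branch [1,3,4] (Cover 0 2) (Branch [2,3,5] (Cover 0 1)
     (Embed edges_F10 [0,1,2,6,4,5,3]))))) (Branch [1,2,4] (Branch [1,2,5] (Branch [1,4,5]
     (Branch [2,4,5] (Cover 0 3) (Branch [0,1,4] (Branch [0,2,5] (Embed edges_H10 [2,0,1,5,3,4,6])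
     (Embed edges_H11 [1,0,2,4,3,5,6])) (Branch [0,2,5] (Embed edges_H8 [3,1,0,5,4,2,6])
     (Embed edges_H10 [5,0,2,4,1,3,6])))) (Branch [0,1,3] (Branch [0,1,4] (Branch [0,2,5]
     (Embed edges_H8 [0,1,2,3,4,5,6]) (Embed edges_H10 [1,0,2,4,3,5,6])) (Branch [0,2,5]
     (Embed edges_H10 [1,2,0,4,5,3,6]) (Embed edges_H9 [0,3,4,5,1,2,6]))) (Branch [0,1,4]
     (Branch [0,2,5] (Embed edges_H10 [2,1,0,5,4,3,6]) (Embed edges_H8 [3,0,1,5,2,4,6]))
     (Branch [0,2,5] (Embed edges_H11 [1,2,0,4,5,3,6]) (Embed edges_H10 [5,2,0,4,1,3,6])))))
     (Branch [0,1,3] (Branch [0,1,4] (Branch [0,2,5] (Branch [0,2,3]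
     (Embed edges_H10 [0,1,2,3,4,5,6]) (Embed edges_H8 [0,1,4,3,2,5,6])) (Cover 2 5)) (Branch [0,2,3]
     (Branch [0,2,5] (Embed edges_H8 [0,3,1,2,5,4,6]) (Embed edges_H10 [1,2,4,0,3,5,6]))
     (Branch [0,2,5] (Embed edges_H7 [0,1,3,4,5,2,6]) (Embed edges_H8 [3,1,5,0,2,4,6]))))
     (Branch [0,1,4] (Branch [0,2,3] (Branch [0,2,5] (Embed edges_H9 [3,0,4,1,5,2,6])
     (Embed edges_H10 [2,1,4,3,0,5,6])) (Branch [0,2,5] (Embed edges_H10 [2,1,4,5,0,3,6])
     (Embed edges_H11 [1,3,5,2,0,4,6]))) (Branch [0,2,3] (Branch [0,2,5]
     (Embed edges_H10 [2,5,0,1,4,3,6]) (Embed edges_H8 [3,4,2,0,1,5,6])) (Branch [0,2,5]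
     (Embed edges_H8 [3,4,2,5,1,0,6]) (Embed edges_H10 [5,1,3,2,0,4,6])))))) (Branch [0,1,4]
     (Branch [0,1,3] (Branch [0,2,5] (Branch [0,2,3] (Branch [0,3,4]
     (Embed edges_H11 [0,1,2,3,4,5,6]) (Embed edges_H10 [0,2,1,3,5,4,6])) (Branch [0,3,4]
     (Embed edges_H10 [0,2,5,1,3,4,6]) (Embed edges_H9 [3,4,0,1,2,5,6]))) (Branch [0,3,4] (Cover 2 5)
     (Branch [0,2,3] (Embed edges_H8 [0,1,3,2,4,5,6]) (Embed edges_H10 [2,0,5,1,3,4,6]))))
     (Branch [0,2,3] (Branch [0,2,5] (Branch [0,3,4] (Embed edges_H10 [0,5,2,1,4,3,6])
     (Embed edges_H8 [0,4,1,3,5,2,6])) (Branch [0,3,4] (Embed edges_H8 [0,4,5,2,1,3,6])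
     (Embed edges_H7 [0,1,3,2,4,5,6]))) (Branch [0,2,5] (Branch [0,3,4]
     (Embed edges_H8 [0,4,5,3,1,2,6]) (Embed edges_H10 [2,4,1,5,3,0,6])) (Branch [0,3,4]
     (Embed edges_H10 [1,3,5,2,0,4,6]) (Embed edges_H8 [3,1,5,4,0,2,6]))))) (Branch [0,2,3]
     (Branch [0,2,5] (Cover 1 4) (Branch [0,1,3] (Branch [0,3,4] (Embed edges_H11 [3,1,5,0,2,4,6])
     (Embed edges_H10 [1,2,4,0,5,3,6])) (Branch [0,3,4] (Embed edges_H10 [1,5,3,0,2,4,6])
     (Embed edges_H8 [3,4,2,0,5,1,6])))) (Branch [0,1,3] (Branch [0,2,5] (Branch [0,3,4]
     (Embed edges_H8 [0,4,5,1,3,2,6]) (Embed edges_H10 [2,4,1,3,5,0,6])) (Branch [0,3,4]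
     (Embed edges_H10 [1,3,5,0,2,4,6]) (Embed edges_H8 [3,1,5,0,4,2,6]))) (Branch [0,2,5]
     (Branch [0,3,4] (Embed edges_H10 [1,5,3,2,4,0,6]) (Embed edges_H11 [1,5,3,2,4,0,6]))
     (Branch [0,3,4] (Embed edges_H9 [0,1,2,3,4,5,6]) (Embed edges_H10 [5,1,3,2,4,0,6]))))))))
     (Branch [0,3,6] (Branch [0,1,6] (Cover 2 5) (Branch [0,3,5] (Cover 1 2) (Branch [1,4,5]
     (Cover 0 2) (Embed edges_F10 [0,1,2,3,4,6,5])))) (Branch [3,4,5] (Cover 0 2)
     (Embed edges_F10 [0,3,1,2,5,6,4])))) (Branch [0,3,6] (Branch [2,5,6] (Branch [0,2,6] (Cover 1 4)
     (Branch [0,3,4] (Cover 1 2) (Branch [2,4,5] (Cover 0 1) (Embed edges_F10 [0,1,2,3,6,5,4]))))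
     (Branch [3,4,5] (Cover 1 2) (Embed edges_F10 [3,0,1,5,2,6,4]))) (Branch [2,5,6] (Branch [3,4,5]
     (Cover 0 1) (Embed edges_F10 [0,1,3,2,6,5,4])) (Branch [3,4,5] (Embed edges_F10 [0,1,2,3,4,5,6])
     (Embed edges_F7 [0,1,2,3,4,5,6]))))"

lemma valid_triangle_certificate: "valid triangle_certificate triangle_transversals"
  by code_simp

lemma triple_increasing:
  fixes e :: "nat set"
  assumes "card e = 3"
  obtains a b c where "e = {a, b, c}" "a < b" "b < c"
proof -
  have "finite e" using assms by (intro card_ge_0_finite) simp
  then obtain l where l: "sorted l" "distinct l" "set l = e"
    by (intro that[of "sorted_list_of_set e"]) simp_all
  then have "length l = 3" using distinct_card[OF l(2)] assms by simp
  then obtain a b c where "l = [a, b, c]" by (auto simp: numeral_3_eq_3 length_Suc_conv)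
  then show ?thesis using that[of a b c] l by auto
qed

lemma triangle_transversals_complete:
  assumes "E \<subseteq> triples {..<7}" "intersecting E" "set ` set triangle_edges \<subseteq> E"
  shows "E \<subseteq> set ` set triangle_transversals"
proof
  fix e assume e: "e \<in> E"
  have "e \<subseteq> {..<7}" "card e = 3" using assms(1) e by (auto simp: triples_def)
  then obtain a b c where abc: "e = {a, b, c}" "a < b" "b < c" "c < 7"
    using triple_increasing[of e] by (metis insert_subset lessThan_iff)
  have "a \<in> set f \<or> b \<in> set f \<or> c \<in> set f" if "f \<in> set triangle_edges" for f
    using intersectingD[OF assms(2) e, of "set f"] that assms(3) abc(1) by blast
  then have "[a, b, c] \<in> set triangle_transversals"
    unfolding triangle_transversals_def using abc(2-4) by (auto simp: list_all_iff)
  then have "set [a, b, c] \<in> set ` set triangle_transversals" by (rule imageI)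
  then show "e \<in> set ` set triangle_transversals" using abc(1) by simp
qed

lemma triples_mono: "A \<subseteq> B \<Longrightarrow> triples A \<subseteq> triples B"
  by (auto simp: triples_def)

lemma triangle_labelled_contained:
  assumes E: "E \<subseteq> triples {..<7}" "intersecting E" "set ` set triangle_edges \<subseteq> E"
    and no_cover: "\<And>a b. \<exists>e\<in>E. a \<notin> e \<and> b \<notin> e" and n: "n \<ge> 7"
  shows "\<exists>T\<in>set seven_vertex_edges. contains_copy (graph_on n T) ({..<n}, E)"
proof -
  have "\<exists>T\<in>set seven_vertex_edges. \<exists>p. distinct p \<and> length p = 7 \<and> set p \<subseteq> {..<7} \<and>
      (\<forall>e\<in>E. (!) p ` e \<in> set ` set T)"
    by (rule valid_sound[OF valid_triangle_certificate triangle_transversals_complete[OF E] E(2) no_cover])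
  then obtain T p where T: "T \<in> set seven_vertex_edges"
    and p: "distinct p" "length p = 7" "set p \<subseteq> {..<7}" "\<And>e. e \<in> E \<Longrightarrow> (!) p ` e \<in> set ` set T"
    by (elim bexE exE conjE) (rule that, assumption+, erule (1) bspec)
  \<comment> \<open>The edges live on the first seven vertices, so the permutation found there
    extends by the identity.\<close>
  define \<phi> where "\<phi> i = (if i < 7 then p ! i else i)" for i
  have lt: "p ! i < 7" if "i < 7" for i using subsetD[OF p(3) nth_mem[of i p]] p(2) that by simp
  have "inj_on \<phi> {..<n}"
  proof (rule inj_onI)
    fix i j assume "\<phi> i = \<phi> j"
    then show "i = j"
      using nth_eq_iff_index_eq[OF p(1), of i j] p(2) lt[of i] lt[of j]
      by (cases "i < 7"; cases "j < 7") (simp_all add: \<phi>_def)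
  qed
  moreover have "\<phi> ` {..<n} \<subseteq> {..<n}"
  proof (rule image_subsetI)
    fix i assume "i \<in> {..<n}"
    then show "\<phi> i \<in> {..<n}" using lt[of i] n by (cases "i < 7") (simp_all add: \<phi>_def)
  qed
  moreover have "\<phi> ` e \<in> set ` set T" if "e \<in> E" for e
  proof -
    have "e \<subseteq> {..<7}" using E(1) that by (auto simp: triples_def)
    then have "\<phi> ` e = (!) p ` e" by (intro image_cong) (auto simp: \<phi>_def)
    then show ?thesis using p(4)[OF that] by simp
  qed
  moreover have "is_3graph ({..<n}, E)" using E(1) triples_mono[of "{..<7}" "{..<n}"] n by (auto simp: is_3graph_def)
  ultimately have "contains_copy (graph_on n T) ({..<n}, E)"
    by (intro contains_copyI[of _ \<phi>]) (simp_all add: graph_on_def)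
  then show ?thesis using T by blast
qed

section \<open>Edges leaving the six vertices of a triangle\<close>

text \<open>Besides \<open>z\<close> the edge has two vertices to hit three triangle edges. Each
  \<open>x\<^sub>i\<close> lies on two of them and misses only the one containing
  \<open>y\<^sub>i\<close>, and each \<open>y\<^sub>i\<close> lies on just one; so the two vertices
  are two x's, or \<open>x\<^sub>i\<close> together with its opposite
  \<open>y\<^sub>i\<close>.\<close>

lemma triangle_transversal_through:
  assumes "card e = 3" "z \<in> e" "z \<notin> {x1, x2, x3, y1, y2, y3}" "distinct [x1, x2, x3, y1, y2, y3]"
    and "e \<inter> {x1, y3, x2} \<noteq> {}" "e \<inter> {x1, y2, x3} \<noteq> {}" "e \<inter> {x2, y1, x3} \<noteq> {}"
  shows "e \<in> {{z, x1, x2}, {z, x1, x3}, {z, x2, x3}, {z, x1, y1}, {z, x2, y2}, {z, x3, y3}}"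
proof -
  have "card (e - {z}) = 2" "finite e" using assms(1,2) by (auto intro: card_ge_0_finite)
  then obtain p q where pq: "e - {z} = {p, q}" by (auto simp: card_2_iff)
  then have e: "e = {z, p, q}" using assms(2) by blast
  have meets: "p \<in> {x1, y3, x2} \<or> q \<in> {x1, y3, x2}" "p \<in> {x1, y2, x3} \<or> q \<in> {x1, y2, x3}"
    "p \<in> {x2, y1, x3} \<or> q \<in> {x2, y1, x3}"
    using assms(3,5-7) unfolding e by auto
  have "{p, q} \<in> {{x1, x2}, {x1, x3}, {x2, x3}, {x1, y1}, {x2, y2}, {x3, y3}}"
  proof -
    consider "p = x1" | "p = x2" | "p = x3" | "p = y1" | "p = y2" | "p = y3"
      | "p \<notin> {x1, x2, x3, y1, y2, y3}" by blast
    then show ?thesis by cases (use assms(4) meets in \<open>auto simp: doubleton_eq_iff\<close>)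
  qed
  from imageI[OF this, of "insert z"] show ?thesis unfolding e by (simp only: image_insert image_empty)
qed

text \<open>Suppose \<open>z\<close> and \<open>w\<close> are different. No pair in the link of
  \<open>u\<close> is a cover, so some edge avoids that pair, and it must then pass through
  \<open>u\<close>. For a pair of x's this forces the opposite-vertex pair disjoint from it, hence
  both links contain some pair \<open>x\<^sub>i\<close>, \<open>y\<^sub>i\<close>. The links
  cross-intersect, so the index is the same and unique in both. The pair \<open>x\<^sub>i\<close>,
  \<open>y\<^sub>i\<close> at \<open>z\<close> also needs a disjoint partner, which can now only
  consist of the other two x's; but that misses \<open>x\<^sub>i\<close>, \<open>y\<^sub>i\<close>
  at \<open>w\<close>.\<close>

lemma triangle_outside_vertex_unique:
  assumes E: "E \<subseteq> triples V" and int: "intersecting E"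
    and no_cover: "\<And>a b. \<exists>e\<in>E. a \<notin> e \<and> b \<notin> e"
    and dist: "distinct [x1, x2, x3, y1, y2, y3]"
    and tri: "{x1, y3, x2} \<in> E" "{x1, y2, x3} \<in> E" "{x2, y1, x3} \<in> E"
    and z: "e \<in> E" "z \<in> e" "z \<notin> {x1, x2, x3, y1, y2, y3}"
    and w: "f \<in> E" "w \<in> f" "w \<notin> {x1, x2, x3, y1, y2, y3}"
  shows "z = w"
proof (rule ccontr)
  assume "z \<noteq> w"
  have opt: "g \<in> {{u, x1, x2}, {u, x1, x3}, {u, x2, x3}, {u, x1, y1}, {u, x2, y2}, {u, x3, y3}}"
    if "g \<in> E" "u \<in> g" "u \<notin> {x1, x2, x3, y1, y2, y3}" for g u
    using that E intersectingD[OF int that(1)] tri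
    by (intro triangle_transversal_through dist) (auto simp: triples_def)
  have avoid: "\<exists>g\<in>{{u, x1, x2}, {u, x1, x3}, {u, x2, x3}, {u, x1, y1}, {u, x2, y2}, {u, x3, y3}}.
      g \<in> E \<and> a \<notin> g \<and> b \<notin> g"
    if u: "u \<notin> {x1, x2, x3, y1, y2, y3}" and ab: "{u, a, b} \<in> E" for a b u
  proof -
    obtain g where g: "g \<in> E" "a \<notin> g" "b \<notin> g" using no_cover by blast
    then have "u \<in> g" using intersectingD[OF int g(1) ab] by auto
    then show ?thesis using opt[OF g(1) _ u] g by blast
  qed
  have match: "{u, x1, x2} \<in> E \<Longrightarrow> {u, x3, y3} \<in> E" "{u, x1, x3} \<in> E \<Longrightarrow> {u, x2, y2} \<in> E"
      "{u, x2, x3} \<in> E \<Longrightarrow> {u, x1, y1} \<in> E"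
    and cross: "{u, x1, y1} \<in> E \<Longrightarrow> {u, x2, x3} \<in> E \<or> {u, x2, y2} \<in> E \<or> {u, x3, y3} \<in> E"
      "{u, x2, y2} \<in> E \<Longrightarrow> {u, x1, x3} \<in> E \<or> {u, x1, y1} \<in> E \<or> {u, x3, y3} \<in> E"
      "{u, x3, y3} \<in> E \<Longrightarrow> {u, x1, x2} \<in> E \<or> {u, x1, y1} \<in> E \<or> {u, x2, y2} \<in> E"
    if u: "u \<notin> {x1, x2, x3, y1, y2, y3}" for u
    using avoid[OF u] dist by force+
  have disj: False if "{z, a, b} \<in> E" "{w, c, d} \<in> E" "{a, b} \<inter> {c, d} = {}"
    "z \<notin> {c, d}" "w \<notin> {a, b}" for a b c d
    using intersectingD[OF int that(1,2)] that(3-5) \<open>z \<noteq> w\<close> by auto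
  have "{z, x1, y1} \<in> E \<or> {z, x2, y2} \<in> E \<or> {z, x3, y3} \<in> E"
    using opt[OF z] match[OF z(3)] z(1) by blast
  moreover have "{w, x1, y1} \<in> E \<or> {w, x2, y2} \<in> E \<or> {w, x3, y3} \<in> E"
    using opt[OF w] match[OF w(3)] w(1) by blast
  moreover have "\<not> ({z, x1, y1} \<in> E \<and> {w, x2, y2} \<in> E)" "\<not> ({z, x1, y1} \<in> E \<and> {w, x3, y3} \<in> E)"
    "\<not> ({z, x2, y2} \<in> E \<and> {w, x1, y1} \<in> E)" "\<not> ({z, x2, y2} \<in> E \<and> {w, x3, y3} \<in> E)"
    "\<not> ({z, x3, y3} \<in> E \<and> {w, x1, y1} \<in> E)" "\<not> ({z, x3, y3} \<in> E \<and> {w, x2, y2} \<in> E)"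
    "\<not> ({z, x2, x3} \<in> E \<and> {w, x1, y1} \<in> E)" "\<not> ({z, x1, x3} \<in> E \<and> {w, x2, y2} \<in> E)"
    "\<not> ({z, x1, x2} \<in> E \<and> {w, x3, y3} \<in> E)"
    using disj[of x1 y1 x2 y2] disj[of x1 y1 x3 y3] disj[of x2 y2 x1 y1] disj[of x2 y2 x3 y3]
      disj[of x3 y3 x1 y1] disj[of x3 y3 x2 y2] disj[of x2 x3 x1 y1] disj[of x1 x3 x2 y2]
      disj[of x1 x2 x3 y3] dist z(3) w(3) by auto
  ultimately show False using cross[OF z(3)] by argo
qed

lemma triangle_contained:
  assumes G: "is_3graph (V, E)" "card V = n" and n: "n \<ge> 7" and int: "intersecting E"
    and no_cover: "\<And>a b. \<exists>e\<in>E. a \<notin> e \<and> b \<notin> e"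
    and dist: "distinct [x1, x2, x3, y1, y2, y3]"
    and tri: "{x1, y3, x2} \<in> E" "{x1, y2, x3} \<in> E" "{x2, y1, x3} \<in> E"
  shows "\<exists>T\<in>set seven_vertex_edges. contains_copy (graph_on n T) (V, E)"
proof -
  let ?U = "{x1, x2, x3, y1, y2, y3}"
  have EV: "E \<subseteq> triples V" and "finite V" using G(1) by (auto simp: is_3graph_def)
  have UV: "?U \<subseteq> V" using EV tri by (auto simp: triples_def)
  have "card ?U < card V" using dist n G(2) by simp
  then have "\<not> V \<subseteq> ?U" using card_mono[of ?U V] by fastforce
  then obtain z0 where z0: "z0 \<in> V" "z0 \<notin> ?U" by blast
  \<comment> \<open>If no edge leaves the six vertices, any spare vertex serves as the seventh; it
    exists since \<open>n \<ge> 7\<close>.\<close>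
  have "\<exists>z\<in>V. z \<notin> ?U \<and> (\<forall>e\<in>E. e \<subseteq> insert z ?U)"
  proof (cases "\<exists>e\<in>E. \<not> e \<subseteq> ?U")
    case True
    then obtain e z where z: "e \<in> E" "z \<in> e" "z \<notin> ?U" by blast
    have "f \<subseteq> insert z ?U" if "f \<in> E" for f
      using triangle_outside_vertex_unique[OF EV int no_cover dist tri z that] by blast
    moreover have "z \<in> V" using z EV by (auto simp: triples_def)
    ultimately show ?thesis using z(3) by blast
  next
    case False
    then show ?thesis using z0 by blast
  qed
  then obtain z where z: "z \<in> V" "z \<notin> ?U" "\<And>e. e \<in> E \<Longrightarrow> e \<subseteq> insert z ?U" by blast
  let ?vs = "[x1, x2, x3, y1, y2, y3, z]"
  have "distinct ?vs" "set ?vs \<subseteq> V" using dist z(1,2) UV by auto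
  then obtain \<phi> where \<phi>: "bij_betw \<phi> V {..<n}" "\<And>i. i < length ?vs \<Longrightarrow> \<phi> (?vs ! i) = i"
    using ex_bij_betw_labelling[OF \<open>finite V\<close> G(2)] by blast
  have idx: "\<phi> x1 = 0" "\<phi> x2 = 1" "\<phi> x3 = 2" "\<phi> y1 = 3" "\<phi> y2 = 4" "\<phi> y3 = 5" "\<phi> z = 6"
    using \<phi>(2)[of 0] \<phi>(2)[of 1] \<phi>(2)[of 2] \<phi>(2)[of 3] \<phi>(2)[of 4] \<phi>(2)[of 5] \<phi>(2)[of 6] by simp_all
  have inj: "inj_on \<phi> V" using \<phi>(1) by (rule bij_betw_imp_inj_on)
  let ?E = "(\<lambda>e. \<phi> ` e) ` E"
  have "isomorphic (V, E) ({..<n}, ?E)" using \<phi>(1) by (auto simp: isomorphic_def)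
  then have copy: "contains_copy ({..<n}, ?E) (V, E)" using isomorphic_contains_copy[OF G(1)] by blast
  have "\<phi> ` e \<in> triples {..<7}" if "e \<in> E" for e
  proof -
    have e: "e \<subseteq> V" "card e = 3" using EV that by (auto simp: triples_def)
    have "\<phi> ` e \<subseteq> \<phi> ` insert z ?U" using z(3)[OF that] by (rule image_mono)
    also have "\<dots> \<subseteq> {..<7}" by (simp add: idx)
    finally show ?thesis using e inj_on_subset[OF inj e(1)] by (simp add: triples_def card_image)
  qed
  then have "?E \<subseteq> triples {..<7}" by blast
  moreover have "intersecting ?E"
    using intersectingD[OF int] by (force simp: intersecting_def)
  moreover have "set ` set triangle_edges \<subseteq> ?E"
    using imageI[OF tri(1), of "\<lambda>e. \<phi> ` e"] imageI[OF tri(2), of "\<lambda>e. \<phi> ` e"]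
      imageI[OF tri(3), of "\<lambda>e. \<phi> ` e"] by (simp add: triangle_edges_def idx insert_commute)
  \<comment> \<open>For a number outside the range of \<open>\<phi>\<close> the value of
    \<open>inv_into\<close> is arbitrary, but such a number lies in no image of an edge.\<close>
  moreover have "\<exists>e\<in>?E. a \<notin> e \<and> b \<notin> e" for a b
  proof -
    obtain e where e: "e \<in> E" "inv_into V \<phi> a \<notin> e" "inv_into V \<phi> b \<notin> e" using no_cover by blast
    moreover have "e \<subseteq> V" using EV e(1) by (auto simp: triples_def)
    ultimately have "a \<notin> \<phi> ` e" "b \<notin> \<phi> ` e" using inv_into_f_f[OF inj] by auto
    then show ?thesis using e(1) by blast
  qed
  ultimately obtain T where "T \<in> set seven_vertex_edges" "contains_copy (graph_on n T) ({..<n}, ?E)"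
    using triangle_labelled_contained[OF _ _ _ _ n, of ?E] by blast
  then show ?thesis using contains_copy_trans[OF G(1) copy] by blast
qed

text \<open>Two edges {a, b, c} and {a, d, e} sharing only \<open>a\<close> exist because {b, c} is
  not a cover. An edge missing \<open>a\<close> meets both remaining pairs; with a third vertex
  outside them it closes a triangle. If that never happens, the family lives on these five
  vertices.\<close>

lemma no_two_cover_contained:
  assumes G: "is_3graph (V, E)" "card V = n" and n: "n \<ge> 7" and int: "intersecting E"
    and no_cover: "\<And>a b. \<exists>e\<in>E. a \<notin> e \<and> b \<notin> e"
  shows "contains_copy ({..<n}, triples {..<5}) (V, E) \<or>
    (\<exists>T\<in>set seven_vertex_edges. contains_copy (graph_on n T) (V, E))"
proof -
  have E: "e \<subseteq> V" "card e = 3" if "e \<in> E" for e using is_3graph_edge[OF G(1)] that by auto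
  obtain h where h: "h \<in> E" using no_cover by blast
  obtain a b c where abc: "h = {a, b, c}" "a \<noteq> b" "a \<noteq> c" "b \<noteq> c"
    using E(2)[OF h] by (auto simp: card_3_iff)
  obtain f where f: "f \<in> E" "b \<notin> f" "c \<notin> f" using no_cover by blast
  have "a \<in> f" using intersectingD[OF int h f(1)] f abc by auto
  moreover have "card (f - {a}) = 2" using E(2)[OF f(1)] \<open>a \<in> f\<close> by (simp add: card_Diff_singleton)
  then obtain d e where de: "f - {a} = {d, e}" "d \<noteq> e" by (auto simp: card_2_iff)
  ultimately have f_eq: "f = {a, d, e}" by blast
  have dist: "distinct [a, b, c, d, e]" using abc f de f_eq by auto
  show ?thesis
  proof (cases "\<exists>g\<in>E. a \<notin> g \<and> \<not> g \<subseteq> {b, c, d, e}")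
    case True
    then obtain g z where g: "g \<in> E" "a \<notin> g" "z \<in> g" "z \<notin> {b, c, d, e}" by blast
    have gh: "b \<in> g \<or> c \<in> g" "d \<in> g \<or> e \<in> g"
      using intersectingD[OF int g(1) h] intersectingD[OF int g(1) f(1)] g(2) abc(1) f_eq by auto
    have g_eq: "g = {p, z, q}" if "p \<in> g" "q \<in> g" "p \<noteq> q" "p \<noteq> z" "q \<noteq> z" for p q
    proof -
      have "card {p, z, q} = 3" using that by simp
      then show ?thesis using card_seteq[of g "{p, z, q}"] E(2)[OF g(1)] that g(3)
        by (metis card_ge_0_finite empty_subsetI insert_subset order_refl zero_less_numeral)
    qed
    \<comment> \<open>The triangle has corners \<open>a\<close>, \<open>b'\<close>,
      \<open>d'\<close>, where \<open>b'\<close> and \<open>d'\<close> are the vertices that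
      \<open>g\<close> shares with the two edges; \<open>z\<close>, \<open>e'\<close>,
      \<open>c'\<close> are opposite to them in this order.\<close>
    have tri: "\<exists>T\<in>set seven_vertex_edges. contains_copy (graph_on n T) (V, E)"
      if "{a, c', b'} \<in> E" "{a, e', d'} \<in> E" "b' \<in> g" "d' \<in> g" "distinct [a, b', d', z, e', c']"
      for b' c' d' e'
    proof -
      have "{b', z, d'} \<in> E" using g_eq[OF that(3,4)] that(5) g(1) by auto
      then show ?thesis using triangle_contained[OF G n int no_cover that(5,1,2)] by blast
    qed
    have az: "a \<noteq> z" using g by blast
    have perm: "{a, c, b} \<in> E" "{a, b, c} \<in> E" "{a, e, d} \<in> E" "{a, d, e} \<in> E"
      using h f(1) abc(1) f_eq by (simp_all add: insert_commute)
    have "\<exists>T\<in>set seven_vertex_edges. contains_copy (graph_on n T) (V, E)"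
      using gh tri[OF perm(1,3)] tri[OF perm(1,4)] tri[OF perm(2,3)] tri[OF perm(2,4)] dist g(4) az
      by auto
    then show ?thesis by blast
  next
    case False
    let ?W = "{a, b, c, d, e}"
    have EW: "k \<subseteq> ?W" if k: "k \<in> E" for k
    proof (cases "a \<in> k")
      case True
      have "card (k - {a}) = 2" using E(2)[OF k] True by (simp add: card_Diff_singleton)
      then obtain p q where pq: "k - {a} = {p, q}" by (auto simp: card_2_iff)
      \<comment> \<open>Since {a, s} is not a cover, some edge avoids both; it meets {a, r, s} in
        \<open>r\<close>, and an edge missing \<open>a\<close> stays inside the four other
        vertices.\<close>
      have "r \<in> ?W" if "k - {a} = {r, s}" for r s
      proof -
        obtain g where g: "g \<in> E" "a \<notin> g" "s \<notin> g" using no_cover by blast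
        have "k \<subseteq> {a, r, s}" using that by blast
        then have "r \<in> g" using intersectingD[OF int g(1) k] g by blast
        then show ?thesis using False g by blast
      qed
      from this[of p q] this[of q p] pq show ?thesis by (auto simp: insert_commute)
    next
      case not_in: False
      then show ?thesis using False k by blast
    qed
    have "contains_copy ({..<n}, triples {..<5}) (V, E)"
    proof (rule contains_copy_labelling[OF G dist])
      show "set [a, b, c, d, e] \<subseteq> V" using E(1)[OF h] E(1)[OF f(1)] abc(1) f_eq by auto
      fix \<phi> k
      assume \<phi>: "\<And>i. i < length [a, b, c, d, e] \<Longrightarrow> \<phi> ([a, b, c, d, e] ! i) = i"
        and k: "k \<in> E" "\<phi> ` k \<in> triples {..<n}"
      have [simp]: "\<phi> a = 0" "\<phi> b = 1" "\<phi> c = 2" "\<phi> d = 3" "\<phi> e = 4"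
        using \<phi>[of 0] \<phi>[of 1] \<phi>[of 2] \<phi>[of 3] \<phi>[of 4] by simp_all
      have "\<phi> ` k \<subseteq> \<phi> ` ?W" using EW[OF k(1)] by (rule image_mono)
      also have "\<dots> \<subseteq> {..<5}" by simp
      finally show "\<phi> ` k \<in> triples {..<5}" using k(2) by (simp add: triples_def)
    qed
    then show ?thesis by blast
  qed
qed

section \<open>Covers and sizes of the extremal families\<close>

definition covers :: "nat \<Rightarrow> 'a hypergraph \<Rightarrow> 'a set set" where
  "covers k H = {T. T \<subseteq> verts H \<and> card T = k \<and> (\<forall>e\<in>edges H. T \<inter> e \<noteq> {})}"

text \<open>With equally many vertices the embedding is a bijection on vertices, and taking
  preimages maps covers of \<open>H\<close> injectively to covers of \<open>G\<close> of the same
  size.\<close>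

lemma contains_copy_card_covers:
  assumes "is_3graph G" "finite (verts H)" "card (verts G) = card (verts H)"
    and "contains_copy H G"
  shows "card (covers k H) \<le> card (covers k G)"
proof -
  obtain \<phi> where \<phi>: "inj_on \<phi> (verts G)" "\<phi> ` verts G \<subseteq> verts H"
    "\<And>e. e \<in> edges G \<Longrightarrow> \<phi> ` e \<in> edges H"
    using contains_copyE[OF assms(4)] by blast
  have surj: "\<phi> ` verts G = verts H"
    using \<phi>(1,2) assms(2,3) by (intro card_subset_eq) (simp_all add: card_image)
  let ?g = "\<lambda>T. {v \<in> verts G. \<phi> v \<in> T}"
  have img: "\<phi> ` ?g T = T" if "T \<subseteq> verts H" for T
    using that surj by auto
  show ?thesis
  proof (rule card_inj_on_le)
    show "inj_on ?g (covers k H)"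
    proof (rule inj_onI)
      fix S T assume "S \<in> covers k H" "T \<in> covers k H" and eq: "?g S = ?g T"
      then have ST: "S \<subseteq> verts H" "T \<subseteq> verts H" by (simp_all only: covers_def mem_Collect_eq)
      show "S = T" using img[OF ST(1)] img[OF ST(2)] unfolding eq by (rule trans[OF sym])
    qed
    show "?g ` covers k H \<subseteq> covers k G"
    proof (rule image_subsetI)
      fix T assume T: "T \<in> covers k H"
      then have TH: "T \<subseteq> verts H" "card T = k" by (auto simp: covers_def)
      have "inj_on \<phi> (?g T)" using \<phi>(1) by (rule inj_on_subset) auto
      then have "card (?g T) = k" using card_image[of \<phi> "?g T"] img[OF TH(1)] TH(2) by simp
      moreover have "?g T \<inter> e \<noteq> {}" if e: "e \<in> edges G" for e
      proof -
        have "T \<inter> \<phi> ` e \<noteq> {}" using T \<phi>(3)[OF e] by (auto simp: covers_def)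
        then show ?thesis using is_3graph_edge(1)[OF assms(1) e] by blast
      qed
      ultimately show "?g T \<in> covers k G" by (simp add: covers_def)
    qed
    show "finite (covers k G)"
      by (rule finite_subset[of _ "Pow (verts G)"]) (use assms(1) in \<open>auto simp: covers_def is_3graph_def\<close>)
  qed
qed

section \<open>Explicit edge lists on seven vertices and their covers\<close>

definition edges_K5 :: "nat list list" where
  "edges_K5 = [[0,1,2], [0,1,3], [0,1,4], [0,2,3], [0,2,4], [0,3,4], [1,2,3], [1,2,4], [1,3,4], [2,3,4]]"

text \<open>The edges of \<open>H1 7\<close>. They belong to \<open>H1 n\<close> for all n \<ge> 7,
  so every cover of \<open>H1 n\<close> covers them; this is enough for an upper bound that holds
  for every n. The lists for \<open>H2\<close> to \<open>H6\<close> are used likewise.\<close>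

definition edges_H1_7 :: "nat list list" where
  "edges_H1_7 = [[0,1,2], [0,1,3], [0,1,4], [0,1,5], [0,1,6], [0,2,3], [0,2,4], [0,2,5], [0,2,6],
     [0,3,4], [0,3,5], [0,3,6], [1,2,3]]"

definition edges_H2_7 :: "nat list list" where
  "edges_H2_7 = [[0,1,2], [0,1,3], [0,1,4], [0,1,5], [0,1,6], [0,2,3], [0,2,4], [0,2,5], [0,2,6],
     [1,2,3], [1,2,4], [1,2,5], [1,2,6]]"

definition edges_H3_7 :: "nat list list" where
  "edges_H3_7 = [[0,1,2], [0,1,3], [0,1,4], [0,1,5], [0,1,6], [0,2,3], [0,2,4], [0,2,5], [0,2,6],
     [0,3,4], [1,2,4], [1,2,3]]"

definition edges_H4_7 :: "nat list list" where
  "edges_H4_7 = [[0,1,2], [0,1,3], [0,1,4], [0,1,5], [0,1,6], [0,3,2], [0,4,2], [0,3,4],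
     [1,2,4], [1,2,3], [1,3,4]]"

definition edges_H5_7 :: "nat list list" where
  "edges_H5_7 = [[0,1,2], [0,1,3], [0,1,4], [0,1,5], [0,1,6], [0,3,2], [0,4,5], [0,3,4],
     [1,2,4], [1,5,3], [1,3,4]]"

definition edges_H6_7 :: "nat list list" where
  "edges_H6_7 = [[0,1,2], [0,1,3], [0,1,4], [0,1,5], [0,1,6], [0,3,2], [0,4,5], [0,3,4],
     [1,2,4], [1,5,3], [0,2,5]]"

text \<open>The index \<open>7\<close> stands for all vertices outside \<open>{..<7}\<close>.\<close>

definition covers_among :: "nat list list \<Rightarrow> (nat \<times> nat) list \<Rightarrow> bool" where
  "covers_among L C \<longleftrightarrow> list_all (\<lambda>e. list_all (\<lambda>v. v < 7) e) L \<and> list_all (\<lambda>(a, b). b < 7) C \<and>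
     list_all (\<lambda>a. list_all (\<lambda>b. a > b \<or> (a, b) \<in> set C \<or> list_ex (\<lambda>e. a \<notin> set e \<and> b \<notin> set e) L)
       [0..<8]) [0..<8]"

lemma covers_amongD:
  assumes "covers_among L C" "a \<le> b" "\<And>e. e \<in> set ` set L \<Longrightarrow> a \<in> e \<or> b \<in> e"
  shows "(a, b) \<in> set C"
proof -
  have min7: "min v 7 \<in> e \<longleftrightarrow> v \<in> e" if "e \<in> set ` set L" for v e
  proof -
    have "\<forall>u\<in>e. u < 7" using assms(1) that by (auto simp: covers_among_def list_all_iff)
    then show ?thesis by (auto simp: min_def)
  qed
  have "min a 7 \<in> set [0..<8]" "min b 7 \<in> set [0..<8]" "min a 7 \<le> min b 7"
    using assms(2) by auto
  then have "(min a 7, min b 7) \<in> set C \<or> (\<exists>e\<in>set L. min a 7 \<notin> set e \<and> min b 7 \<notin> set e)"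
    using assms(1) unfolding covers_among_def list_all_iff list_ex_iff by (metis not_le)
  then have "(min a 7, min b 7) \<in> set C" using assms(3) min7 by blast
  moreover have "min b 7 < 7"
    using assms(1) calculation unfolding covers_among_def list_all_iff by blast
  ultimately show ?thesis using assms(2) by (simp add: min_def split: if_splits)
qed

text \<open>A cover with one element would show up in \<open>C\<close> as a pair of equal entries,
  which strictness forbids.\<close>

lemma covers_among_small_covers:
  assumes C: "covers_among L C" and L: "set ` set L \<subseteq> edges H"
  shows "covers 2 (H :: nat hypergraph) \<subseteq> (\<lambda>(a, b). {a, b}) ` set C"
    and "list_all (\<lambda>(a, b). a < b) C \<Longrightarrow> covers 1 H = {}"
proof -
  show "covers 2 H \<subseteq> (\<lambda>(a, b). {a, b}) ` set C"
  proof
    fix T assume T: "T \<in> covers 2 H"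
    then have "card T = 2" and T_meets: "\<And>e. e \<in> edges H \<Longrightarrow> T \<inter> e \<noteq> {}"
      by (simp_all add: covers_def)
    then obtain p q where pq: "T = {p, q}" by (auto simp: card_2_iff)
    define a b where "a = min p q" and "b = max p q"
    have ab: "T = {a, b}" "a \<le> b" unfolding pq a_def b_def by (auto simp: min_def max_def)
    have "a \<in> e \<or> b \<in> e" if e: "e \<in> set ` set L" for e
      using T_meets[OF subsetD[OF L e]] unfolding ab(1) by simp
    then have "(a, b) \<in> set C" using covers_amongD[OF C ab(2)] by blast
    then show "T \<in> (\<lambda>(a, b). {a, b}) ` set C" using ab(1) by (auto intro!: image_eqI[of _ _ "(a, b)"])
  qed
  show "covers 1 H = {}" if lt: "list_all (\<lambda>(a, b). a < b) C"
  proof (rule ccontr)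
    assume "covers 1 H \<noteq> {}"
    then obtain T where "T \<in> covers 1 H" by blast
    then have "card T = 1" and T_meets: "\<And>e. e \<in> edges H \<Longrightarrow> T \<inter> e \<noteq> {}"
      by (simp_all add: covers_def)
    then obtain a where a: "T = {a}" by (auto simp: card_1_singleton_iff)
    have "a \<in> e \<or> a \<in> e" if e: "e \<in> set ` set L" for e
      using T_meets[OF subsetD[OF L e]] unfolding a by simp
    then have "(a, a) \<in> set C" using covers_amongD[OF C] by blast
    then show False using lt by (auto simp: list_all_iff)
  qed
qed

lemma covers_among_checks:
  "covers_among edges_H1_7 [(0,1), (0,2), (0,3)]" "covers_among edges_H2_7 [(0,1), (0,2), (1,2)]"
  "covers_among edges_H3_7 [(0,1), (0,2)]" "covers_among edges_H4_7 [(0,1)]"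
  "covers_among edges_H5_7 [(0,1)]" "covers_among edges_H6_7 [(0,1)]"
  "list_all (\<lambda>L. covers_among L []) (edges_K5 # seven_vertex_edges)"
  by code_simp+

lemma edges_7_subset:
  assumes "n \<ge> 7"
  shows "set ` set edges_H1_7 \<subseteq> edges (H1 n)" "set ` set edges_H2_7 \<subseteq> edges (H2 n)"
    "set ` set edges_H3_7 \<subseteq> edges (H3 n)" "set ` set edges_H4_7 \<subseteq> edges (H4 n)"
    "set ` set edges_H5_7 \<subseteq> edges (H5 n)" "set ` set edges_H6_7 \<subseteq> edges (H6 n)"
  using assms
  by (simp_all add: edges_H1_7_def edges_H2_7_def edges_H3_7_def edges_H4_7_def edges_H5_7_def
      edges_H6_7_def H1_def H2_def H3_def H4_def H5_def H6_def mem_up triples_def)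

lemma is_3graph_H:
  assumes "n \<ge> 7"
  shows "is_3graph (full_star n)" "is_3graph (H1 n)" "is_3graph (H2 n)" "is_3graph (H3 n)"
    "is_3graph (H4 n)" "is_3graph (H5 n)" "is_3graph (H6 n)"
proof -
  have "up n A \<subseteq> triples {..<n}" for A by (auto simp: up_def)
  moreover have "{a, b, c} \<in> triples {..<n}" if "distinct [a, b, c]" "a < 7" "b < 7" "c < 7" for a b c
    using that assms by (auto simp: triples_def)
  ultimately show "is_3graph (full_star n)" "is_3graph (H1 n)" "is_3graph (H2 n)" "is_3graph (H3 n)"
    "is_3graph (H4 n)" "is_3graph (H5 n)" "is_3graph (H6 n)"
    by (simp_all add: is_3graph_def full_star_def H1_def H2_def H3_def H4_def H5_def H6_def)
qed

lemma verts_H: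
  "verts (full_star n) = {..<n}" "verts (H1 n) = {..<n}" "verts (H2 n) = {..<n}"
  "verts (H3 n) = {..<n}" "verts (H4 n) = {..<n}" "verts (H5 n) = {..<n}" "verts (H6 n) = {..<n}"
  "verts (graph_on n L) = {..<n}"
  by (simp_all add: full_star_def H1_def H2_def H3_def H4_def H5_def H6_def graph_on_def)

text \<open>Reduces the parts \<open>up n A\<close>, which grow with \<open>n\<close>, to the single
  set \<open>A\<close>; what remains is a check on a fixed finite family.\<close>

lemma intersecting_generators:
  assumes "intersecting M" "\<And>e. e \<in> E \<Longrightarrow> \<exists>m\<in>M. m \<subseteq> e"
  shows "intersecting E"
  unfolding intersecting_def
proof (intro ballI)
  fix e f assume "e \<in> E" "f \<in> E"
  then obtain k m where "k \<in> M" "m \<in> M" "k \<subseteq> e" "m \<subseteq> f" using assms(2) by meson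
  then show "e \<inter> f \<noteq> {}" using intersectingD[OF assms(1), of k m] by blast
qed

lemma intersecting_H:
  "intersecting (edges (full_star n))" "intersecting (edges (H1 n))" "intersecting (edges (H2 n))"
  "intersecting (edges (H3 n))" "intersecting (edges (H4 n))" "intersecting (edges (H5 n))"
  "intersecting (edges (H6 n))"
proof -
  show "intersecting (edges (full_star n))"
    by (rule intersecting_generators[of "{{0}}"]) (auto simp: intersecting_def full_star_def mem_up)
  show "intersecting (edges (H1 n))"
    by (rule intersecting_generators[of "{{0, 1}, {0, 2}, {0, 3}, {1, 2, 3}}"])
      (simp add: intersecting_def, auto simp: H1_def mem_up)
  show "intersecting (edges (H2 n))"
    by (rule intersecting_generators[of "{{0, 1}, {0, 2}, {1, 2}}"])
      (simp add: intersecting_def, auto simp: H2_def mem_up)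
  show "intersecting (edges (H3 n))"
    by (rule intersecting_generators[of "{{0, 1}, {0, 2}, {0, 3, 4}, {1, 2, 4}, {1, 2, 3}}"])
      (simp add: intersecting_def, auto simp: H3_def mem_up)
  show "intersecting (edges (H4 n))"
    by (rule intersecting_generators[of
          "{{0, 1}, {0, 3, 2}, {0, 4, 2}, {0, 3, 4}, {1, 2, 4}, {1, 2, 3}, {1, 3, 4}}"])
      (simp add: intersecting_def, auto simp: H4_def mem_up)
  show "intersecting (edges (H5 n))"
    by (rule intersecting_generators[of
          "{{0, 1}, {0, 3, 2}, {0, 4, 5}, {0, 3, 4}, {1, 2, 4}, {1, 5, 3}, {1, 3, 4}}"])
      (simp add: intersecting_def, auto simp: H5_def mem_up)
  show "intersecting (edges (H6 n))"
    by (rule intersecting_generators[of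
          "{{0, 1}, {0, 3, 2}, {0, 4, 5}, {0, 3, 4}, {1, 2, 4}, {1, 5, 3}, {0, 2, 5}}"])
      (simp add: intersecting_def, auto simp: H6_def mem_up)
qed

lemma covers_H:
  assumes "n \<ge> 7"
  shows "{{0}} \<subseteq> covers 1 (full_star n)" "{{0, 1}, {0, 2}, {0, 3}} \<subseteq> covers 2 (H1 n)"
    "{{0, 1}, {0, 2}, {1, 2}} \<subseteq> covers 2 (H2 n)" "{{0, 1}, {0, 2}} \<subseteq> covers 2 (H3 n)"
    "{{0, 1}} \<subseteq> covers 2 (H4 n)" "{{0, 1}} \<subseteq> covers 2 (H5 n)" "{{0, 1}} \<subseteq> covers 2 (H6 n)"
  using assms
  by (auto simp: covers_def full_star_def H1_def H2_def H3_def H4_def H5_def H6_def mem_up)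

section \<open>Sizes by inclusion and exclusion\<close>

lemma card_full_star:
  assumes "n > 0"
  shows "card (edges (full_star n)) = (n - 1) choose 2"
proof -
  let ?P = "{B. B \<subseteq> {1..<n} \<and> card B = 2}"
  have "edges (full_star n) = insert 0 ` ?P"
  proof (intro subset_antisym subsetI)
    fix f assume "f \<in> edges (full_star n)"
    then have f: "f \<subseteq> {..<n}" "card f = 3" "0 \<in> f"
      by (auto simp: full_star_def mem_up triples_def)
    then have "f - {0} \<in> ?P" by (auto simp: card_Diff_singleton)
    moreover have "f = insert 0 (f - {0})" using f(3) by blast
    ultimately show "f \<in> insert 0 ` ?P" by blast
  next
    fix f assume "f \<in> insert 0 ` ?P"
    then obtain B where B: "B \<subseteq> {1..<n}" "card B = 2" "f = insert 0 B" by blast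
    then have "finite B" "0 \<notin> B" using finite_subset by auto
    then show "f \<in> edges (full_star n)"
      using B assms by (auto simp: full_star_def mem_up triples_def)
  qed
  moreover have "inj_on (insert 0) ?P"
  proof (rule inj_onI)
    fix A B assume "A \<in> ?P" "B \<in> ?P" "insert 0 A = insert 0 B"
    moreover have "0 \<notin> A" "0 \<notin> B" using calculation by auto
    ultimately show "A = B" by (simp add: insert_ident)
  qed
  moreover have "card ?P = (n - 1) choose 2" using n_subsets[of "{1..<n}" 2] by simp
  ultimately show ?thesis by (simp add: card_image)
qed

lemma finite_up: "finite (up n A)"
  by (rule finite_subset[of _ "Pow {..<n}"]) (auto simp: up_def triples_def)

lemma card_up_pair:
  assumes "a < n" "b < n" "a \<noteq> b"
  shows "card (up n {a, b}) = n - 2"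
proof -
  have "up n {a, b} = (\<lambda>k. {a, b, k}) ` ({..<n} - {a, b})"
  proof (intro subset_antisym subsetI)
    fix f assume f: "f \<in> up n {a, b}"
    then have "card (f - {a, b}) = 1" using assms(3) by (auto simp: mem_up triples_def card_Diff_subset)
    then obtain k where "f - {a, b} = {k}" by (auto simp: card_1_singleton_iff)
    then have "f = {a, b, k}" "k \<in> {..<n} - {a, b}" using f by (auto simp: mem_up triples_def)
    then show "f \<in> (\<lambda>k. {a, b, k}) ` ({..<n} - {a, b})" by blast
  qed (use assms in \<open>auto simp: mem_up triples_def\<close>)
  moreover have "inj_on (\<lambda>k. {a, b, k}) ({..<n} - {a, b})" by (auto simp: inj_on_def)
  ultimately show ?thesis using assms by (simp add: card_image card_Diff_subset)
qed

lemma up_Int: "up n A \<inter> up n B = up n (A \<union> B)"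
  by (auto simp: up_def)

lemma up_triple:
  assumes "a < n" "b < n" "c < n" "distinct [a, b, c]"
  shows "up n {a, b, c} = {{a, b, c}}"
proof -
  have "f = {a, b, c}" if "f \<in> up n {a, b, c}" for f
    using that card_seteq[of f "{a, b, c}"] assms(4)
    by (auto simp: mem_up triples_def intro: finite_subset)
  moreover have "{a, b, c} \<in> up n {a, b, c}" using assms by (simp add: mem_up triples_def)
  ultimately show ?thesis by (auto simp del: insert_iff)
qed

lemma card_up_pair_Un:
  assumes "a < n" "b < n" "c < n" "distinct [a, b, c]"
  shows "card (up n {a, b} \<union> up n {a, c}) = 2 * n - 5"
proof -
  have "up n {a, b} \<inter> up n {a, c} = {{a, b, c}}"
    using up_triple[OF assms] by (simp add: up_Int insert_commute)
  then show ?thesis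
    using card_Un_Int[OF finite_up finite_up, of n "{a, b}" n "{a, c}"] card_up_pair[of a n b]
      card_up_pair[of a n c] assms by auto
qed

lemma card_H1:
  assumes "n \<ge> 7"
  shows "card (edges (H1 n)) = 3 * n - 8"
proof -
  \<comment> \<open>This gives (2n - 5) + (n - 2) - 2 = 3n - 9 edges through 0; the edge {1, 2, 3}
    is the last one.\<close>
  have "(up n {0, 1} \<union> up n {0, 2}) \<inter> up n {0, 3} = {{0, 1, 3}, {0, 2, 3}}"
    using assms up_triple[of 0 n 1 3] up_triple[of 0 n 2 3]
    by (simp add: Int_Un_distrib2 up_Int insert_commute)
  moreover have "{0, 1, 3} \<noteq> {0, 2, 3 :: nat}" by (simp add: set_eq_subset)
  ultimately have "card (up n {0, 1} \<union> up n {0, 2} \<union> up n {0, 3}) = 3 * n - 9"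
    using card_Un_Int[of "up n {0, 1} \<union> up n {0, 2}" "up n {0, 3}"] assms
    by (simp add: finite_up card_up_pair card_up_pair_Un)
  moreover have "{1, 2, 3} \<notin> up n {0, 1} \<union> up n {0, 2} \<union> up n {0, 3}" by (simp add: mem_up)
  ultimately show ?thesis
    using assms by (simp add: H1_def finite_up)
qed

lemma card_H2:
  assumes "n \<ge> 7"
  shows "card (edges (H2 n)) = 3 * n - 8"
proof -
  \<comment> \<open>Only one triple is counted twice here, so the size is (2n - 5) + (n - 2) -
    1.\<close>
  have "(up n {0, 1} \<union> up n {0, 2}) \<inter> up n {1, 2} = {{0, 1, 2}}"
    using assms up_triple[of 0 n 1 2] by (simp add: Int_Un_distrib2 up_Int insert_commute)
  then show ?thesis
    using card_Un_Int[of "up n {0, 1} \<union> up n {0, 2}" "up n {1, 2}"] assms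
    by (simp add: H2_def finite_up card_up_pair card_up_pair_Un)
qed

text \<open>An increasing list is determined by its set, so different lists give different edges and
  counting becomes taking a length.\<close>

lemma card_Un_triples:
  assumes "finite A" "list_all (\<lambda>e. sorted e \<and> distinct e) L" "distinct L" "set ` set L \<inter> A = {}"
  shows "card (A \<union> set ` set L) = card A + length L"
proof -
  have "inj_on set (set L)"
    using assms(2) by (auto simp: inj_on_def list_all_iff intro: sorted_distinct_set_unique)
  then show ?thesis
    using assms by (subst card_Un_disjoint) (auto simp: card_image distinct_card)
qed

lemma card_H3:
  assumes "n \<ge> 7"
  shows "card (edges (H3 n)) = 2 * n - 2"
proof -
  have "edges (H3 n) = (up n {0, 1} \<union> up n {0, 2}) \<union> set ` set [[0,3,4], [1,2,4], [1,2,3]]"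
    by (simp add: H3_def)
  also have "card \<dots> = 2 * n - 5 + 3"
    using assms by (subst card_Un_triples) (simp_all add: finite_up card_up_pair_Un mem_up)
  finally show ?thesis using assms by simp
qed

lemma card_H456:
  assumes "n \<ge> 7"
  shows "card (edges (H4 n)) = n + 4" "card (edges (H5 n)) = n + 4" "card (edges (H6 n)) = n + 4"
proof -
  have *: "card (up n {0, 1} \<union> set ` set L) = n + 4"
    if "length L = 6" "list_all (\<lambda>e. sorted e \<and> distinct e) L" "distinct L"
      "list_all (\<lambda>e. 0 \<notin> set e \<or> 1 \<notin> set e) L" for L
    using that assms
    by (subst card_Un_triples) (auto simp: finite_up card_up_pair mem_up list_all_iff)
  \<comment> \<open>The triples are rewritten in increasing order, as \<open>card_Un_triples\<close>
    requires.\<close>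
  have "edges (H4 n) = up n {0, 1} \<union> set ` set [[0,2,3], [0,2,4], [0,3,4], [1,2,4], [1,2,3], [1,3,4]]"
    by (simp add: H4_def insert_commute)
  then show "card (edges (H4 n)) = n + 4" by (simp only:) (rule *, simp_all)
  have "edges (H5 n) = up n {0, 1} \<union> set ` set [[0,2,3], [0,4,5], [0,3,4], [1,2,4], [1,3,5], [1,3,4]]"
    by (simp add: H5_def insert_commute)
  then show "card (edges (H5 n)) = n + 4" by (simp only:) (rule *, simp_all)
  have "edges (H6 n) = up n {0, 1} \<union> set ` set [[0,2,3], [0,4,5], [0,3,4], [1,2,4], [1,3,5], [0,2,5]]"
    by (simp add: H6_def insert_commute)
  then show "card (edges (H6 n)) = n + 4" by (simp only:) (rule *, simp_all)
qed

section \<open>The hierarchy\<close>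

definition triple_list :: "nat list list \<Rightarrow> bool" where
  "triple_list L \<longleftrightarrow> distinct L \<and>
     list_all (\<lambda>e. sorted e \<and> distinct e \<and> length e = 3 \<and> list_all (\<lambda>v. v < 7) e) L \<and>
     list_all (\<lambda>e. list_all (\<lambda>f. list_ex (\<lambda>v. v \<in> set f) e) L) L"

lemma triple_list_seven: "list_all triple_list (edges_K5 # seven_vertex_edges)"
  by code_simp

lemma length_seven:
  "length edges_F7 = 7" "list_all (\<lambda>L. length L = 10) (edges_K5 # ten_edge_lists)"
  by code_simp+

lemma graph_on_triple_list:
  assumes "triple_list L" "n \<ge> 7"
  shows "is_3graph (graph_on n L)" "intersecting (edges (graph_on n L))"
    "card (edges (graph_on n L)) = length L"
proof -
  have "set e \<in> triples {..<n}" if "e \<in> set L" for e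
    using assms that by (force simp: triple_list_def triples_def list_all_iff distinct_card)
  then show "is_3graph (graph_on n L)" by (auto simp: is_3graph_def graph_on_def)
  show "intersecting (edges (graph_on n L))"
    using assms(1)
    by (fastforce simp: triple_list_def intersecting_def graph_on_def list_all_iff list_ex_iff)
  show "card (edges (graph_on n L)) = length L"
    using card_Un_triples[of "{}" L] assms(1)
    by (simp add: triple_list_def graph_on_def list_all_iff)
qed

text \<open>The case of equal \<open>a\<close> and \<open>b\<close> says that each of the seven
  vertices lies in an edge.\<close>

definition covers_all_pairs :: "nat list list \<Rightarrow> bool" where
  "covers_all_pairs L \<longleftrightarrow> list_all (\<lambda>a. list_all (\<lambda>b. list_ex (\<lambda>e. a \<in> set e \<and> b \<in> set e) L) [0..<7]) [0..<7]"

text \<open>Any two points of the Fano plane lie on a line. The families on five or six vertices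
  miss vertex 6 altogether, and in \<open>edges_F10\<close> no edge contains both 3 and 4.\<close>

lemma covers_all_pairs_checks:
  "covers_all_pairs edges_F7" "list_all (\<lambda>L. \<not> covers_all_pairs L) (edges_K5 # ten_edge_lists)"
  by code_simp+

text \<open>Every vertex below 7 lies in an edge of \<open>L\<close>, whose image is an edge of
  \<open>M\<close> and hence below 7. The embedding therefore permutes the seven vertices, so the
  pairs covered by image edges are all pairs.\<close>

lemma covers_all_pairs_mono:
  assumes L: "covers_all_pairs L" and M: "triple_list M" and n: "n \<ge> 7"
    and copy: "contains_copy (graph_on n M) (graph_on n L)"
  shows "covers_all_pairs M"
proof -
  obtain \<phi> where \<phi>: "inj_on \<phi> {..<n}" "\<And>e. e \<in> set L \<Longrightarrow> \<phi> ` set e \<in> set ` set M"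
    using contains_copyE[OF copy] unfolding graph_on_def by (metis fst_conv imageI snd_conv)
  have pair: "\<exists>f\<in>set M. \<phi> a \<in> set f \<and> \<phi> b \<in> set f" if ab: "a < 7" "b < 7" for a b
  proof -
    have "\<exists>e\<in>set L. a \<in> set e \<and> b \<in> set e"
      using L ab by (simp add: covers_all_pairs_def list_all_iff list_ex_iff)
    then obtain e where e: "e \<in> set L" "a \<in> set e" "b \<in> set e" by blast
    obtain f where "f \<in> set M" "\<phi> ` set e = set f" using \<phi>(2)[OF e(1)] by blast
    then show ?thesis using e(2,3) by blast
  qed
  have "\<phi> a < 7" if "a < 7" for a
    using pair[OF that that] M by (auto simp: triple_list_def list_all_iff)
  then have "\<phi> ` {..<7} \<subseteq> {..<7}" by auto
  moreover have "inj_on \<phi> {..<7}" using \<phi>(1) by (rule inj_on_subset) (use n in auto)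
  ultimately have surj: "\<phi> ` {..<7} = {..<7}" by (simp add: endo_inj_surj)
  have "\<exists>f\<in>set M. a \<in> set f \<and> b \<in> set f" if ab: "a < 7" "b < 7" for a b
  proof -
    have "a \<in> \<phi> ` {..<7}" "b \<in> \<phi> ` {..<7}" unfolding surj using ab by simp_all
    then obtain a' b' where "a' < 7" "b' < 7" "a = \<phi> a'" "b = \<phi> b'" by auto
    then show ?thesis using pair[of a' b'] by simp
  qed
  then show ?thesis by (auto simp: covers_all_pairs_def list_all_iff list_ex_iff)
qed

definition level :: "nat \<Rightarrow> nat \<Rightarrow> nat hypergraph set" where
  "level n s =
     (if s = 1 then {full_star n} else if s = 2 then {H1 n, H2 n} else if s = 3 then {H3 n}
      else if s = 4 then {H4 n, H5 n, H6 n}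
      else if s = 5 then graph_on n ` set (edges_K5 # ten_edge_lists)
      else if s = 6 then {graph_on n edges_F7} else {})"

definition level_size :: "nat \<Rightarrow> nat \<Rightarrow> nat" where
  "level_size n s =
     (if s = 1 then (n - 1) choose 2 else if s = 2 then 3 * n - 8 else if s = 3 then 2 * n - 2
      else if s = 4 then n + 4 else if s = 5 then 10 else 7)"

lemma set_seven_vertex_edges: "set seven_vertex_edges = insert edges_F7 (set (ten_edge_lists))"
  by (simp add: seven_vertex_edges_def)

lemma level_cases:
  assumes "H \<in> level n s"
  obtains "s = 1" "H = full_star n" | "s = 2" "H = H1 n" | "s = 2" "H = H2 n" | "s = 3" "H = H3 n"
  | "s = 4" "H = H4 n" | "s = 4" "H = H5 n" | "s = 4" "H = H6 n"
  | L where "s = 5" "L \<in> set (edges_K5 # ten_edge_lists)" "H = graph_on n L"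
  | "s = 6" "H = graph_on n edges_F7"
  using assms by (auto simp: level_def split: if_splits)

lemma level_lists:
  assumes "L \<in> set (edges_K5 # ten_edge_lists) \<or> L = edges_F7"
  shows "triple_list L" "covers_among L []"
  using assms triple_list_seven covers_among_checks(7) unfolding list_all_iff
  by (auto simp: set_seven_vertex_edges)

lemma level_properties:
  assumes n: "n \<ge> 7" and H: "H \<in> level n s"
  shows "is_3graph H" "card (verts H) = n" "\<not> contains_copy H M2" "card (edges H) = level_size n s"
proof -
  have V: "card (verts H) = n" using H by (cases rule: level_cases) (simp_all add: verts_H)
  have "is_3graph H \<and> intersecting (edges H) \<and> card (edges H) = level_size n s"
    using H
  proof (cases rule: level_cases)
    case (8 L)
    then have "length L = 10" using length_seven(2) by (auto simp: list_all_iff)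
    then show ?thesis
      using 8 level_lists(1)[of L] graph_on_triple_list[OF _ n, of L] by (simp add: level_size_def)
  next
    case 9
    then show ?thesis
      using level_lists(1)[of edges_F7] graph_on_triple_list[OF _ n, of edges_F7] length_seven(1)
      by (simp add: level_size_def)
  qed (use n in \<open>simp_all add: is_3graph_H intersecting_H level_size_def card_full_star card_H1
      card_H2 card_H3 card_H456\<close>)
  then show "is_3graph H" "card (verts H) = n" "\<not> contains_copy H M2" "card (edges H) = level_size n s"
    using V M2_free_iff_intersecting[of H] by auto
qed

lemma card_covers_ge:
  fixes H :: "nat hypergraph"
  assumes "C \<subseteq> covers k H" "finite (verts H)"
  shows "card C \<le> card (covers k H)"
  by (rule card_mono[OF finite_subset[of _ "Pow (verts H)"] assms(1)]) (use assms(2) in \<open>auto simp: covers_def\<close>)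

text \<open>Subtraction is truncated: \<open>5 - s\<close> takes the values 3, 2, 1, 0, 0 for s = 2,
  ..., 6. Together with the matching upper bound this gives exact counts.\<close>

lemma covers_lower:
  assumes n: "n \<ge> 7" and H: "H \<in> level n s"
  shows "s = 1 \<Longrightarrow> card (covers 1 H) \<ge> 1" "s > 1 \<Longrightarrow> card (covers 2 H) \<ge> 5 - s"
proof -
  have fin: "finite (verts H)" using level_properties(1)[OF n H] by (simp add: is_3graph_def)
  show "card (covers 1 H) \<ge> 1" if "s = 1"
    using H that card_covers_ge[OF covers_H(1)[OF n]] by (auto simp: level_def verts_H)
  show "card (covers 2 H) \<ge> 5 - s" if s: "s > 1"
    using H
  proof (cases rule: level_cases)
    case 2
    then show ?thesis using card_covers_ge[OF covers_H(2)[OF n]] by (simp add: verts_H doubleton_eq_iff)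
  next
    case 3
    then show ?thesis using card_covers_ge[OF covers_H(3)[OF n]] by (simp add: verts_H doubleton_eq_iff)
  next
    case 4
    then show ?thesis using card_covers_ge[OF covers_H(4)[OF n]] by (simp add: verts_H doubleton_eq_iff)
  next
    case 5
    then show ?thesis using card_covers_ge[OF covers_H(5)[OF n]] by (simp add: verts_H)
  next
    case 6
    then show ?thesis using card_covers_ge[OF covers_H(6)[OF n]] by (simp add: verts_H)
  next
    case 7
    then show ?thesis using card_covers_ge[OF covers_H(7)[OF n]] by (simp add: verts_H)
  qed (use s in simp_all)
qed

lemma card_small_covers_le:
  fixes H :: "nat hypergraph"
  assumes "covers_among L C" "set ` set L \<subseteq> edges H" "list_all (\<lambda>(a, b). a < b) C"
  shows "covers 1 H = {} \<and> card (covers 2 H) \<le> length C"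
proof
  show "covers 1 H = {}" by (rule covers_among_small_covers(2)[OF assms])
  have "card (covers 2 H) \<le> card ((\<lambda>(a, b). {a, b}) ` set C)"
    using covers_among_small_covers(1)[OF assms(1,2)] by (intro card_mono) simp_all
  also have "\<dots> \<le> length C" using card_image_le[of "set C"] card_length[of C] le_trans by blast
  finally show "card (covers 2 H) \<le> length C" .
qed

lemma covers_upper:
  assumes n: "n \<ge> 7" and H: "H \<in> level n s" and s: "s > 1"
  shows "covers 1 H = {} \<and> card (covers 2 H) \<le> 5 - s"
  using H
proof (cases rule: level_cases)
  case 2
  then show ?thesis
    using card_small_covers_le[OF covers_among_checks(1) edges_7_subset(1)[OF n]] by simp
next
  case 3
  then show ?thesis
    using card_small_covers_le[OF covers_among_checks(2) edges_7_subset(2)[OF n]] by simp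
next
  case 4
  then show ?thesis
    using card_small_covers_le[OF covers_among_checks(3) edges_7_subset(3)[OF n]] by simp
next
  case 5
  then show ?thesis
    using card_small_covers_le[OF covers_among_checks(4) edges_7_subset(4)[OF n]] by simp
next
  case 6
  then show ?thesis
    using card_small_covers_le[OF covers_among_checks(5) edges_7_subset(5)[OF n]] by simp
next
  case 7
  then show ?thesis
    using card_small_covers_le[OF covers_among_checks(6) edges_7_subset(6)[OF n]] by simp
next
  case (8 L)
  then show ?thesis
    using card_small_covers_le[of L "[]" H] level_lists(2)[of L] by (simp add: graph_on_def)
next
  case 9
  then show ?thesis
    using card_small_covers_le[of edges_F7 "[]" H] level_lists(2)[of edges_F7] by (simp add: graph_on_def)
qed (use s in simp)

text \<open>A cover of size one separates the star from everything later. For 1 < s < 5 the count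
  \<open>5 - s\<close> is positive and exceeds \<open>5 - t\<close>, truncated or not. Orders five
  and six both have count zero, so they are separated by the covered pairs.\<close>

lemma level_not_contained:
  assumes n: "n \<ge> 7" and H: "H \<in> level n s" and K: "K \<in> level n t" and st: "1 \<le> s" "s < t"
  shows "\<not> contains_copy H K"
proof
  assume copy: "contains_copy H K"
  have "t \<le> 6" using K by (cases rule: level_cases) simp_all
  have le: "card (covers k H) \<le> card (covers k K)" for k
    using contains_copy_card_covers[OF level_properties(1)[OF n K] _ _ copy]
      level_properties(1,2)[OF n H] level_properties(2)[OF n K] by (simp add: is_3graph_def)
  have upper: "covers 1 K = {}" "card (covers 2 K) \<le> 5 - t" using covers_upper[OF n K] st by auto
  consider "s = 1" | "1 < s" "s < 5" | "s = 5" "t = 6" using st \<open>t \<le> 6\<close> by linarith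
  then show False
  proof cases
    case 1
    then show False using covers_lower(1)[OF n H] le[of 1] upper(1) by simp
  next
    case 2
    then show False using covers_lower(2)[OF n H] le[of 2] upper(2) st by simp
  next
    case 3
    have K: "K = graph_on n edges_F7" using K 3 by (simp add: level_def)
    obtain L where L: "L \<in> set (edges_K5 # ten_edge_lists)" "H = graph_on n L"
      using H 3 by (cases rule: level_cases) auto
    have "covers_all_pairs L"
      using covers_all_pairs_mono[OF covers_all_pairs_checks(1) level_lists(1) n] copy L K by blast
    then show False using covers_all_pairs_checks(2) L(1) by (auto simp: list_all_iff)
  qed
qed

text \<open>At n = 6 the formulas for the orders one to five all give 10; n = 7 is the first value
  at which they are strictly ordered.\<close>

lemma level_size_decreasing:
  assumes n: "n \<ge> 7" and st: "1 \<le> s" "s < t" "t \<le> 6"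
  shows "level_size n t < level_size n s"
proof -
  have star: "3 * n - 8 < (n - 1) choose 2"
  proof -
    obtain m where m: "n = m + 7" using n by (metis add.commute le_Suc_ex)
    have "(n - 1) choose 2 = (m + 6) * (m + 5) div 2" by (simp add: m choose_two add.commute)
    \<comment> \<open>In terms of m = n - 7 the number 3m + 14 is one more than 3n - 8.\<close>
    moreover have "2 * (3 * m + 14) \<le> (m + 6) * (m + 5)" by (simp add: algebra_simps)
    ultimately have "3 * m + 14 \<le> (n - 1) choose 2"
      using div_le_mono[of "2 * (3 * m + 14)" _ 2] by simp
    then show ?thesis using m by simp
  qed
  have steps: "level_size n 2 < level_size n 1" "level_size n 3 < level_size n 2"
    "level_size n 4 < level_size n 3" "level_size n 5 < level_size n 4" "level_size n 6 < level_size n 5"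
    using star n by (simp_all add: level_size_def)
  have "s \<in> {1, 2, 3, 4, 5}" "t \<in> {2, 3, 4, 5, 6}" using st by auto
  then show ?thesis using st(2) steps by (elim insertE emptyE; hypsubst; linarith)
qed

lemma triples_5: "triples {..<5} = set ` set edges_K5"
proof (rule card_subset_eq[symmetric])
  have "triples {..<5 :: nat} = {B. B \<subseteq> {..<5} \<and> card B = 3}" by (simp add: triples_def)
  then have "card (triples {..<5 :: nat}) = 5 choose 3" by (simp add: n_subsets)
  also have "\<dots> = 10" by (simp add: numeral_eq_Suc)
  also have "10 = card (set ` set edges_K5)"
    using graph_on_triple_list(3)[of edges_K5 7] level_lists(1)[of edges_K5] length_seven(2)
    by (simp add: graph_on_def)
  finally show "card (set ` set edges_K5) = card (triples {..<5 :: nat})" by simp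
  show "set ` set edges_K5 \<subseteq> triples {..<5}" by (simp add: edges_K5_def triples_def)
qed (auto simp: triples_def intro: finite_subset[of _ "Pow {..<5}"])

lemma level_complete:
  assumes n: "n \<ge> 7" and K: "is_3graph K" "card (verts K) = n" "\<not> contains_copy K M2"
  shows "\<exists>s\<in>{1..6}. \<exists>H\<in>level n s. contains_copy H K"
proof -
  have int: "intersecting (edges K)" using K M2_free_iff_intersecting by blast
  have G: "is_3graph (verts K, edges K)" using K(1) by simp
  have "\<exists>s. \<exists>H\<in>level n s. contains_copy H K"
  proof (cases "\<exists>v. \<forall>e\<in>edges K. v \<in> e")
    case True
    \<comment> \<open>With no edges the common vertex may lie outside \<open>verts K\<close>, so in
      that case any vertex of \<open>K\<close> is taken instead.\<close>
    obtain x where "x \<in> verts K" "\<And>e. e \<in> edges K \<Longrightarrow> x \<in> e"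
    proof (cases "edges K = {}")
      case True
      have "verts K \<noteq> {}" using K(2) n by auto
      then show ?thesis using that True by blast
    next
      case False
      then show ?thesis using that True is_3graph_edge(1)[OF K(1)] by blast
    qed
    then have "contains_copy (full_star n) K" using contains_copy_full_star[OF G K(2)] by simp
    moreover have "full_star n \<in> level n 1" by (simp add: level_def)
    ultimately show ?thesis by blast
  next
    case no_one: False
    show ?thesis
    proof (cases "\<exists>x y. \<forall>e\<in>edges K. x \<in> e \<or> y \<in> e")
      case True
      then obtain x y where xy: "\<And>e. e \<in> edges K \<Longrightarrow> x \<in> e \<or> y \<in> e" by blast
      have "\<exists>e\<in>edges K. v \<notin> e" for v using no_one by blast
      then have "\<exists>H\<in>{H1 n, H2 n, H3 n, H4 n, H5 n, H6 n}. contains_copy H K"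
        using two_cover_contained[OF G K(2) int _ xy] by simp
      moreover have "{H1 n, H2 n, H3 n, H4 n, H5 n, H6 n} = level n 2 \<union> level n 3 \<union> level n 4"
        by (auto simp: level_def)
      ultimately show ?thesis by blast
    next
      case False
      then have "\<exists>e\<in>edges K. a \<notin> e \<and> b \<notin> e" for a b by blast
      then have "contains_copy ({..<n}, triples {..<5}) K \<or>
          (\<exists>T\<in>set seven_vertex_edges. contains_copy (graph_on n T) K)"
        using no_two_cover_contained[OF G K(2) n int] by simp
      moreover have "({..<n}, triples {..<5}) = graph_on n edges_K5" by (simp add: graph_on_def triples_5)
      ultimately obtain T where "T \<in> set (edges_K5 # seven_vertex_edges)" "contains_copy (graph_on n T) K"
        by auto
      moreover have "graph_on n T \<in> level n 5 \<union> level n 6"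
        if "T \<in> set (edges_K5 # seven_vertex_edges)" for T
        using that by (auto simp: level_def set_seven_vertex_edges)
      ultimately show ?thesis by blast
    qed
  qed
  then obtain s H where sH: "H \<in> level n s" "contains_copy H K" by blast
  moreover have "s \<in> {1..6}" using sH(1) by (cases rule: level_cases) simp_all
  ultimately show ?thesis by blast
qed

section \<open>The labelled lists identified with the named 3-graphs\<close>

lemma isomorphic_add_isolated:
  assumes "inj_on f (verts T)" "f ` verts T = {..<k}" "k \<le> n"
  shows "isomorphic (add_isolated T (n - k)) ({..<n}, (\<lambda>e. f ` e) ` edges T)"
proof -
  let ?\<phi> = "case_sum f (\<lambda>i. k + i)"
  have lt: "f v < k" if "v \<in> verts T" for v using assms(2) that by blast
  have "bij_betw ?\<phi> (verts T <+> {..<n - k}) {..<n}"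
    unfolding bij_betw_def
  proof
    show "inj_on ?\<phi> (verts T <+> {..<n - k})"
    proof (rule inj_onI)
      fix a b assume "a \<in> verts T <+> {..<n - k}" "b \<in> verts T <+> {..<n - k}" "?\<phi> a = ?\<phi> b"
      then show "a = b"
        using lt inj_onD[OF assms(1)] by (elim PlusE) (auto dest: lt)
    qed
    have "?\<phi> ` (verts T <+> {..<n - k}) = f ` verts T \<union> (\<lambda>i. k + i) ` {..<n - k}"
      by (simp add: Plus_def image_Un image_image)
    also have "(\<lambda>i. k + i) ` {..<n - k} = {k..<n}"
      using image_add_atLeastLessThan[of k 0 "n - k"] assms(3) by (simp add: lessThan_atLeast0)
    finally show "?\<phi> ` (verts T <+> {..<n - k}) = {..<n}" using assms(2,3) by auto
  qed
  moreover have "(\<lambda>e. f ` e) ` edges T = (\<lambda>e. ?\<phi> ` e) ` edges (add_isolated T (n - k))"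
    by (simp add: add_isolated_def image_image)
  ultimately show ?thesis unfolding isomorphic_def by (auto simp: add_isolated_def)
qed

text \<open>The isomorphism is reversed so that \<open>iso_type_eq\<close> starts from
  \<open>graph_on n L\<close>, which is already known to be a 3-graph.\<close>

lemma iso_type_add_isolated:
  assumes f: "inj_on f (verts T)" "f ` verts T = {..<k}" "k \<le> n"
    and T: "edges T \<subseteq> Pow (verts T)" "(\<lambda>e. f ` e) ` edges T = set ` set L"
    and L: "triple_list L" "n \<ge> 7"
  shows "iso_type (add_isolated T (n - k)) = iso_type (graph_on n L)"
proof -
  have "isomorphic (add_isolated T (n - k)) (graph_on n L)"
    using isomorphic_add_isolated[OF f] unfolding T(2) graph_on_def .
  moreover have "edges (add_isolated T (n - k)) \<subseteq> Pow (verts (add_isolated T (n - k)))"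
    using T(1) by (auto simp: add_isolated_def)
  ultimately have "isomorphic (graph_on n L) (add_isolated T (n - k))" using isomorphic_sym_Pow by blast
  then show ?thesis by (rule iso_type_eq[OF graph_on_triple_list(1)[OF L], symmetric])
qed

text \<open>The numbering 0, ..., 6 behind the edge lists. \<open>X 0\<close> and \<open>X 1\<close>
  share a label, but only the indices 1, 2, 3 occur in \<open>U\<close>.\<close>

fun label :: "vertex \<Rightarrow> nat" where
  "label (X i) = i - 1"
| "label (Y i) = 2 + i"
| "label Z = 6"

lemma label_U:
  "inj_on label U" "label ` U = {..<6}" "inj_on label (U \<union> {Z})" "label ` (U \<union> {Z}) = {..<7}"
proof -
  have "{..<6 :: nat} = {0, 1, 2, 3, 4, 5}" "{..<7 :: nat} = {0, 1, 2, 3, 4, 5, 6}" by auto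
  then show "inj_on label U" "label ` U = {..<6}" "inj_on label (U \<union> {Z})" "label ` (U \<union> {Z}) = {..<7}"
    by (simp_all add: U_def insert_commute)
qed

text \<open>Turns the comprehensions in \<open>A1\<close> and \<open>A2\<close> into unions over
  explicit finite sets, which simplification can expand.\<close>

lemma distinct_pairs_eq_UN:
  "{f i j | i j. i \<in> S \<and> j \<in> S \<and> i \<noteq> j} = (\<Union>i\<in>S. \<Union>j\<in>S - {i}. {f i j})"
  by blast

lemma A1_eq: "A1 = {{X 1, Y 1, Y 2}, {X 1, Y 1, Y 3}, {X 2, Y 2, Y 1}, {X 2, Y 2, Y 3},
    {X 3, Y 3, Y 1}, {X 3, Y 3, Y 2}}"
proof -
  have "A1 = (\<Union>i\<in>{1, 2, 3}. \<Union>j\<in>{1, 2, 3} - {i}. {{X i, Y i, Y j}})"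
    unfolding A1_def by (rule distinct_pairs_eq_UN)
  then show ?thesis by (simp add: insert_Diff_if Un_insert_left Un_insert_right insert_commute)
qed

lemma A2_eq: "A2 = {{X 1, X 2, Y 2}, {X 1, X 3, Y 3}, {X 2, X 1, Y 1}, {X 2, X 3, Y 3},
    {X 3, X 1, Y 1}, {X 3, X 2, Y 2}}"
proof -
  have "A2 = (\<Union>i\<in>{1, 2, 3}. \<Union>j\<in>{1, 2, 3} - {i}. {{X i, X j, Y j}})"
    unfolding A2_def by (rule distinct_pairs_eq_UN)
  then show ?thesis by (simp add: insert_Diff_if Un_insert_left Un_insert_right insert_commute)
qed

lemma A3_eq: "A3 = {{X 1, Y 1, Y 3}, {X 2, Y 2, Y 1}, {X 2, Y 2, Y 3},
    {X 3, Y 3, Y 1}, {X 3, Y 3, Y 2}, {X 2, X 3, Y 3}}"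
  by (simp add: A3_def A1_eq set_eq_subset)

lemma A4_eq: "A4 = {{X 2, Y 2, Y 1}, {X 2, Y 2, Y 3},
    {X 3, Y 3, Y 1}, {X 3, Y 3, Y 2}, {X 2, X 3, Y 3}, {X 2, X 3, Y 2}}"
  by (simp add: A4_def A1_eq set_eq_subset)

lemmas six_vertex_defs = H7_def H8_def H9_def H10_def H11_def C3_def A1_eq A2_eq A3_eq A4_eq

lemma label_edges:
  "(\<lambda>e. label ` e) ` edges H7 = set ` set edges_H7"
  "(\<lambda>e. label ` e) ` edges H8 = set ` set edges_H8"
  "(\<lambda>e. label ` e) ` edges H9 = set ` set edges_H9"
  "(\<lambda>e. label ` e) ` edges H10 = set ` set edges_H10"
  "(\<lambda>e. label ` e) ` edges H11 = set ` set edges_H11"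
  "(\<lambda>e. label ` e) ` edges F7 = set ` set edges_F7"
  "(\<lambda>e. label ` e) ` edges F10 = set ` set edges_F10"
  by (simp_all add: six_vertex_defs F7_def F10_def triangle_edges_def edges_H7_def edges_H8_def
      edges_H9_def edges_H10_def edges_H11_def edges_F7_def edges_F10_def set_eq_subset)

lemma edges_Pow:
  "edges H7 \<subseteq> Pow U" "edges H8 \<subseteq> Pow U" "edges H9 \<subseteq> Pow U" "edges H10 \<subseteq> Pow U"
  "edges H11 \<subseteq> Pow U" "edges F7 \<subseteq> Pow (U \<union> {Z})" "edges F10 \<subseteq> Pow (U \<union> {Z})"
  by (simp_all add: six_vertex_defs F7_def F10_def U_def)

lemma iso_type_targets:
  assumes n: "n \<ge> 7"
  shows "iso_type (add_isolated K5 (n - 5)) = iso_type (graph_on n edges_K5)"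
    "iso_type (add_isolated F10 (n - 7)) = iso_type (graph_on n edges_F10)"
    "iso_type (add_isolated F7 (n - 7)) = iso_type (graph_on n edges_F7)"
    "iso_type (add_isolated H7 (n - 6)) = iso_type (graph_on n edges_H7)"
    "iso_type (add_isolated H8 (n - 6)) = iso_type (graph_on n edges_H8)"
    "iso_type (add_isolated H9 (n - 6)) = iso_type (graph_on n edges_H9)"
    "iso_type (add_isolated H10 (n - 6)) = iso_type (graph_on n edges_H10)"
    "iso_type (add_isolated H11 (n - 6)) = iso_type (graph_on n edges_H11)"
proof -
  have lists: "triple_list edges_K5" "triple_list edges_F10" "triple_list edges_F7"
    "triple_list edges_H7" "triple_list edges_H8" "triple_list edges_H9" "triple_list edges_H10"
    "triple_list edges_H11"
    using triple_list_seven by (simp_all add: seven_vertex_edges_def ten_edge_lists_def)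
  show "iso_type (add_isolated K5 (n - 5)) = iso_type (graph_on n edges_K5)"
    by (rule iso_type_add_isolated[of id])
      (use n lists in \<open>auto simp: K5_def triples_5[symmetric] triples_def\<close>)
  have seven: "iso_type (add_isolated T (n - 7)) = iso_type (graph_on n L)"
    if "verts T = U \<union> {Z}" "edges T \<subseteq> Pow (U \<union> {Z})" "(\<lambda>e. label ` e) ` edges T = set ` set L"
      "triple_list L" for T L
    by (rule iso_type_add_isolated[of label]) (use that n label_U in simp_all)
  have six: "iso_type (add_isolated T (n - 6)) = iso_type (graph_on n L)"
    if "verts T = U" "edges T \<subseteq> Pow U" "(\<lambda>e. label ` e) ` edges T = set ` set L"
      "triple_list L" for T L
    by (rule iso_type_add_isolated[of label]) (use that n label_U in simp_all)
  show "iso_type (add_isolated F10 (n - 7)) = iso_type (graph_on n edges_F10)"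
    "iso_type (add_isolated F7 (n - 7)) = iso_type (graph_on n edges_F7)"
    by (rule seven; use lists label_edges edges_Pow in \<open>simp add: F7_def F10_def\<close>)+
  show "iso_type (add_isolated H7 (n - 6)) = iso_type (graph_on n edges_H7)"
    "iso_type (add_isolated H8 (n - 6)) = iso_type (graph_on n edges_H8)"
    "iso_type (add_isolated H9 (n - 6)) = iso_type (graph_on n edges_H9)"
    "iso_type (add_isolated H10 (n - 6)) = iso_type (graph_on n edges_H10)"
    "iso_type (add_isolated H11 (n - 6)) = iso_type (graph_on n edges_H11)"
    by (rule six, simp add: H7_def H8_def H9_def H10_def H11_def, rule edges_Pow, rule label_edges,
        rule lists)+
qed

theorem theorem4:
  fixes n :: nat
  assumes "n \<ge> 7"
  shows
    "(turan_ex 1 n M2 = Some ((n - 1) choose 2) \<and>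
      turan_Ex 1 n M2 = {iso_type (full_star n)}) \<and>
     (turan_ex 2 n M2 = Some (3 * n - 8) \<and>
      turan_Ex 2 n M2 = {iso_type (H1 n), iso_type (H2 n)}) \<and>
     (turan_ex 3 n M2 = Some (2 * n - 2) \<and>
      turan_Ex 3 n M2 = {iso_type (H3 n)}) \<and>
     (turan_ex 4 n M2 = Some (n + 4) \<and>
      turan_Ex 4 n M2 = {iso_type (H4 n), iso_type (H5 n), iso_type (H6 n)}) \<and>
     (turan_ex 5 n M2 = Some 10 \<and>
      turan_Ex 5 n M2 =
        {iso_type (add_isolated K5 (n - 5)), iso_type (add_isolated F10 (n - 7))} \<union>
        (\<lambda>H. iso_type (add_isolated H (n - 6))) ` {H7, H8, H9, H10, H11}) \<and>
     (turan_ex 6 n M2 = Some 7 \<and>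
      turan_Ex 6 n M2 = {iso_type (add_isolated F7 (n - 7))}) \<and>
     (\<forall>s\<ge>7. turan_ex s n M2 = None)"
proof -
  have nonempty: "level n s \<noteq> {}" if "s \<in> {1..6}" for s
    using that by (auto simp: level_def)
  have graph: "is_3graph H \<and> card (verts H) = n" if "s \<in> {1..6}" "H \<in> level n s" for s H
    using level_properties(1,2)[OF assms that(2)] by simp
  have free: "\<not> contains_copy H M2" if "s \<in> {1..6}" "H \<in> level n s" for s H
    by (rule level_properties(3)[OF assms that(2)])
  have size: "card (edges H) = level_size n s" if "s \<in> {1..6}" "H \<in> level n s" for s H
    by (rule level_properties(4)[OF assms that(2)])
  have not_contained: "\<not> contains_copy H K"
    if "1 \<le> s" "s < t" "t \<le> 6" "H \<in> level n s" "K \<in> level n t" for s t H K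
    by (rule level_not_contained[OF assms that(4,5,1,2)])
  note facts = is_3graph_M2 nonempty graph free size level_size_decreasing[OF assms] not_contained
    level_complete[OF assms]
  have ex: "turan_ex s n M2 = Some (level_size n s) \<and> turan_Ex s n M2 = iso_type ` level n s"
    if "s \<in> {1..6}" for s
    by (rule extremal_hierarchy(1)[where m = 6 and L = "level n" and e = "level_size n"])
      (fact facts that)+
  have none: "turan_ex s n M2 = None" if "s > 6" for s
    by (rule extremal_hierarchy(2)[where m = 6 and L = "level n" and e = "level_size n"])
      (fact facts that)+
  show ?thesis
    using none ex[of 1] ex[of 2] ex[of 3] ex[of 4] ex[of 5] ex[of 6]
    by (simp add: level_def level_size_def iso_type_targets[OF assms] ten_edge_lists_def insert_commute)
qed

end
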